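(* Let $(A,\cdot,\alpha)$ and $(A^*,\circ,(\alpha^{-1})^* )$ be two (regular) Hom-pre-Lie algebras, where $A$ is finite-dimensional and $A^*$ is the dual space of $A$. Then the following conditions are equivalent: (i) $(A,A^* )$ is a Hom-pre-Lie bialgebra; (ii) $(A,A^*,\mathrm{ad}^\star,-R^\star,\mathfrak{ad}^\star,-\mathcal{R}^\star)$ is a matched pair of Hom-pre-Lie algebras; (iii) $(A\oplus A^*,A,A^* )$ is the standard Manin triple for Hom-pre-Lie algebras, i.e. $(A\oplus A^*,\diamond,\alpha\oplus(\alpha^{-1})^* )$ with $$(x+\xi)\diamond(y+\eta)=x\cdot y+\mathfrak{ad}^\star_\xi y-\mathcal{R}^\star_\eta x+\xi\circ\eta+\mathrm{ad}^\star_x\eta-R^\star_y\xi$$ is a Hom-pre-Lie algebra and, together with the bilinear form $\bar\omega(x+\xi,y+\eta)=\langle\xi,y\rangle-\langle\eta,x\rangle$ and the subalgebras $A$, $A^*$, it forms a Manin triple for Hom-pre-Lie algebras.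
   Context: All vector spaces are finite-dimensional over a field; $\mathfrak{gl}(V)$ is the space of linear endomorphisms of $V$; for a linear map $f:V\to W$, $f^*:W^*\to V^*$ is the usual transpose, and $V^{**}=V$, $(V\otimes V)^*=V^*\otimes V^*$. Hom-pre-Lie algebra: $(A,\cdot,\alpha)$ with $\cdot:A\otimes A\to A$ bilinear, $\alpha\in\mathfrak{gl}(A)$, $\alpha(x\cdot y)=\alpha(x)\cdot\alpha(y)$ and $(x\cdot y)\cdot\alpha(z)-\alpha(x)\cdot(y\cdot z)=(y\cdot x)\cdot\alpha(z)-\alpha(y)\cdot(x\cdot z)$. It is regular if $\alpha$ is invertible; all Hom-pre-Lie algebras here are regular. Put $[x,y]=x\cdot y-y\cdot x$; then $A^C=(A,[\cdot,\cdot],\alpha)$ is a Hom-Lie algebra (skew bracket, $\alpha$ a bracket morphism, $[\alpha(x),[y,z]]+[\alpha(y),[z,x]]+[\alpha(z),[x,y]]=0$), the sub-adjacent Hom-Lie algebra. Put $L_xy=x\cdot y$, $R_xy=y\cdot x$, $\mathrm{ad}_x=L_x-R_x$. Representation of a Hom-Lie algebra $(\mathfrak g,[\cdot,\cdot],\phi)$ on $V$ with respect to $\beta\in\mathfrak{gl}(V)$: linear $\rho:\mathfrak g\to\mathfrak{gl}(V)$ with $\rho(\phi(x))\beta=\beta\rho(x)$ and $\rho([x,y])\beta=\rho(\phi(x))\rho(y)-\rho(\phi(y))\rho(x)$. Representation $(V,\beta,\rho,\mu)$ of a Hom-pre-Lie algebra $(A,\cdot,\alpha)$: $\rho$ is a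 representation of $A^C$ on $V$ with respect to $\beta$, and $\mu:A\to\mathfrak{gl}(V)$ is linear with $\beta\mu(x)=\mu(\alpha(x))\beta$ and $\mu(\alpha(y))\mu(x)-\mu(x\cdot y)\beta=\mu(\alpha(y))\rho(x)-\rho(\alpha(x))\mu(y)$. For $x\in A,\xi\in A^*$ and $M\in\{L,R,\mathrm{ad}\}$: $\langle M^*_x\xi,y\rangle=-\langle\xi,M_xy\rangle$ and $M^\star_x\xi=M^*_{\alpha(x)}\big((\alpha^{-2})^*\xi\big)$. For the algebra on $A^*$ write $\{\xi,\eta\}=\xi\circ\eta-\eta\circ\xi$, $\mathcal L_\xi\eta=\xi\circ\eta$, $\mathcal R_\xi\eta=\eta\circ\xi$, $\mathfrak{ad}=\mathcal L-\mathcal R$, and for $\mathcal M\in\{\mathcal L,\mathcal R,\mathfrak{ad}\}$: $\langle \mathcal M^*_\xi x,\eta\rangle=-\langle x,\mathcal M_\xi\eta\rangle$, $\mathcal M^\star_\xi x=\mathcal M^*_{(\alpha^{-1})^*\xi}(\alpha^2(x))$. Matched pair of Hom-pre-Lie algebras $(A,B,l_A,r_A,l_B,r_B)$: Hom-pre-Lie algebras $(A,\cdot,\alpha_A)$, $(B,\circ,\alpha_B)$ with commutators $[\cdot,\cdot]$, $\{\cdot,\cdot\}$, linear maps $l_A,r_A:A\to\mathfrak{gl}(B)$, $l_B,r_B:B\to\mathfrak{gl}(A)$ such that $(B,\alpha_B,l_A,r_A)$ is a representation of $A$, $(A,\alpha_A,l_B,r_B)$ is a representation of $B$, and for all $x,y\in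 A$, $a,b\in B$: $r_A(\alpha_A(x))\{a,b\}=r_A(l_B(b)x)\alpha_B(a)-r_A(l_B(a)x)\alpha_B(b)+\alpha_B(a)\circ(r_A(x)b)-\alpha_B(b)\circ(r_A(x)a)$; $l_A(\alpha_A(x))(a\circ b)=-l_A(l_B(a)x-r_B(a)x)\alpha_B(b)+(l_A(x)a-r_A(x)a)\circ\alpha_B(b)+r_A(r_B(b)x)\alpha_B(a)+\alpha_B(a)\circ(l_A(x)b)$; $r_B(\alpha_B(a))[x,y]=r_B(l_A(y)a)\alpha_A(x)-r_B(l_A(x)a)\alpha_A(y)+\alpha_A(x)\cdot(r_B(a)y)-\alpha_A(y)\cdot(r_B(a)x)$; $l_B(\alpha_B(a))(x\cdot y)=-l_B(l_A(x)a-r_A(x)a)\alpha_A(y)+(l_B(a)x-r_B(a)x)\cdot\alpha_A(y)+r_B(r_A(y)a)\alpha_A(x)+\alpha_A(x)\cdot(l_B(a)y)$. Quadratic Hom-pre-Lie algebra $(\mathcal A,\cdot,\alpha,\omega)$: a Hom-pre-Lie algebra with a nondegenerate skew-symmetric bilinear form $\omega$ with $\omega(\alpha(x),\alpha(y))=\omega(x,y)$ and $\omega(x\cdot y,\alpha(z))=-\omega(\alpha(y),[x,z])$. Manin triple $(\mathcal A,A_1,A_2)$: $(\mathcal A,\cdot,\alpha,\omega)$ is a quadratic Hom-pre-Lie algebra, $(A_1,\cdot_1,\alpha_1)$, $(A_2,\cdot_2,\alpha_2)$ are isotropic Hom-pre-Lie subalgebras, $\mathcal A=A_1\oplus A_2$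 as vector spaces and $\alpha=\alpha_1\oplus\alpha_2$. 1-cocycle of a Hom-Lie algebra $(\mathfrak g,[\cdot,\cdot],\phi)$ associated to a representation $(V,\beta,\rho)$: linear $\delta:\mathfrak g\to V$ with $\delta([x,y])=\rho(\phi(x))\delta(y)-\rho(\phi(y))\delta(x)$. Hom-pre-Lie bialgebra: let $\varphi^*:A\to A\otimes A$ and $\psi^*:A^*\to A^*\otimes A^*$ be given by $\langle\varphi^*(x),\xi\otimes\eta\rangle=\langle x,\xi\circ\eta\rangle$ and $\langle\psi^*(\xi),x\otimes y\rangle=\langle\xi,x\cdot y\rangle$. The pair $(A,A^* )$ is a Hom-pre-Lie bialgebra if (a) $\varphi^*$ is a 1-cocycle of $A^C$ associated to the representation $x\mapsto L^{-2}_x\otimes\alpha+\alpha\otimes\mathrm{ad}^{-2}_x$ on $A\otimes A$ (with respect to $\alpha\otimes\alpha$), where $L^{-2}_xy=\alpha^{-2}(x)\cdot y$, $\mathrm{ad}^{-2}_xy=[\alpha^{-2}(x),y]$; (b) $\psi^*$ is a 1-cocycle of $(A^* )^C=(A^*,\{\cdot,\cdot\},(\alpha^{-1})^* )$ associated to the representation $\xi\mapsto\mathcal L^{-2}_\xi\otimes(\alpha^{-1})^*+(\alpha^{-1})^*\otimes\mathfrak{ad}^{-2}_\xi$ on $A^*\otimes A^*$ (with respect to $(\alpha^{-1})^*\otimes(\alpha^{-1})^*$), where $\mathcal L^{-2}_\xi\eta=(\alpha^2)^*(\xi)\circ\eta$, $\mathfrak{ad}^{-2}_\xi\eta=\{(\alpha^2)^*(\xi),\eta\}$.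 *)

theory Defs
  imports Complex_Main "HOL-Library.Function_Algebras" "HOL-Library.Product_Plus"
begin

section \<open>Finite-dimensional vector spaces as carriers\<close>

text \<open>
  A finite-dimensional vector space over a field \<open>'k\<close> is a finitely generated subspace \<open>V\<close> of an
  ambient vector space. Carriers are needed because the dual space is a set of functionals and a
  Manin triple speaks about subspaces. Maps are only meaningful on their carriers: every equation
  below is required for elements of the carriers only.
\<close>

locale fd_vspace = vector_space scale
  for scale :: "'k::field \<Rightarrow> 'v::ab_group_add \<Rightarrow> 'v" +
  fixes V :: "'v set"
  assumes finitely_spanned: "\<exists>B. finite B \<and> span B = V"

definition linear_on ::
  "('k \<Rightarrow> 'v::plus \<Rightarrow> 'v) \<Rightarrow> ('k \<Rightarrow> 'w::plus \<Rightarrow> 'w) \<Rightarrow> 'v set \<Rightarrow> 'w set \<Rightarrow> ('v \<Rightarrow> 'w) \<Rightarrow> bool" where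
  "linear_on s t V W f \<longleftrightarrow>
     (\<forall>x\<in>V. f x \<in> W) \<and>
     (\<forall>x\<in>V. \<forall>y\<in>V. f (x + y) = f x + f y) \<and>
     (\<forall>c. \<forall>x\<in>V. f (s c x) = t c (f x))"

text \<open>
  A linear map \<open>V \<rightarrow> gl(W)\<close> is the same thing as an operation \<open>f\<close> with \<open>bilinear_on s t t V W W f\<close>.
\<close>

definition bilinear_on ::
  "('k \<Rightarrow> 'u::plus \<Rightarrow> 'u) \<Rightarrow> ('k \<Rightarrow> 'v::plus \<Rightarrow> 'v) \<Rightarrow> ('k \<Rightarrow> 'w::plus \<Rightarrow> 'w) \<Rightarrow>
   'u set \<Rightarrow> 'v set \<Rightarrow> 'w set \<Rightarrow> ('u \<Rightarrow> 'v \<Rightarrow> 'w) \<Rightarrow> bool" where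
  "bilinear_on s t r U V W f \<longleftrightarrow>
     (\<forall>x\<in>U. linear_on t r V W (f x)) \<and> (\<forall>y\<in>V. linear_on s r U W (\<lambda>x. f x y))"

definition fun_scale :: "'k::times \<Rightarrow> ('x \<Rightarrow> 'k) \<Rightarrow> 'x \<Rightarrow> 'k" where
  "fun_scale c f = (\<lambda>x. c * f x)"

definition prod_scale ::
  "('k \<Rightarrow> 'v \<Rightarrow> 'v) \<Rightarrow> ('k \<Rightarrow> 'w \<Rightarrow> 'w) \<Rightarrow> 'k \<Rightarrow> 'v \<times> 'w \<Rightarrow> 'v \<times> 'w" where
  "prod_scale s t c = map_prod (s c) (t c)"


section \<open>Dual spaces and transposes\<close>

text \<open>
  The dual space of \<open>V\<close>: linear functionals on \<open>V\<close>, represented by their extension by zero to the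
  ambient type, so that equality of functionals is equality of functions. If \<open>V = UNIV\<close> these are
  just the linear functionals.
\<close>

definition dual :: "('k::field \<Rightarrow> 'v::ab_group_add \<Rightarrow> 'v) \<Rightarrow> 'v set \<Rightarrow> ('v \<Rightarrow> 'k) set" where
  "dual s V = {\<xi>. linear_on s (*) V UNIV \<xi> \<and> (\<forall>x. x \<notin> V \<longrightarrow> \<xi> x = 0)}"

definition transpose_on :: "'v set \<Rightarrow> ('v \<Rightarrow> 'w) \<Rightarrow> ('w \<Rightarrow> 'k::zero) \<Rightarrow> 'v \<Rightarrow> 'k" where
  "transpose_on V f \<xi> = (\<lambda>x. if x \<in> V then \<xi> (f x) else 0)"

text \<open>The canonical map \<open>V \<rightarrow> V**\<close>, through which \<open>V\<close> is identified with \<open>V**\<close>.\<close>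

definition bidual_embed ::
  "('k::field \<Rightarrow> 'v::ab_group_add \<Rightarrow> 'v) \<Rightarrow> 'v set \<Rightarrow> 'v \<Rightarrow> ('v \<Rightarrow> 'k) \<Rightarrow> 'k" where
  "bidual_embed s V x = (\<lambda>\<xi>. if \<xi> \<in> dual s V then \<xi> x else 0)"


section \<open>Tensor squares\<close>

text \<open>
  The tensor square \<open>V \<otimes> V\<close> is the space of bilinear forms on \<open>V* \<times> V*\<close>; this is
  \<open>V \<otimes> V = (V* \<otimes> V*)*\<close>. The pairing of \<open>t \<in> V \<otimes> V\<close> with \<open>\<xi> \<otimes> \<eta>\<close> is then \<open>t \<xi> \<eta>\<close>, and
  \<open>(f \<otimes> g) t = t \<circ> (f* \<otimes> g*)\<close>. The lemmas \<open>pure_tensor_bilinear\<close>, \<open>tensor_map_pure\<close>,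
  \<open>tensor_lift_exists\<close> and \<open>tensor_lift_unique\<close> below state that this is the tensor product, with
  its universal property, and the usual \<open>f \<otimes> g\<close>.
\<close>

definition tensor_square ::
  "('k::field \<Rightarrow> 'v::ab_group_add \<Rightarrow> 'v) \<Rightarrow> 'v set \<Rightarrow> (('v \<Rightarrow> 'k) \<Rightarrow> ('v \<Rightarrow> 'k) \<Rightarrow> 'k) set" where
  "tensor_square s V =
     {t. bilinear_on fun_scale fun_scale (*) (dual s V) (dual s V) UNIV t \<and>
         (\<forall>\<xi> \<eta>. \<xi> \<notin> dual s V \<or> \<eta> \<notin> dual s V \<longrightarrow> t \<xi> \<eta> = 0)}"

definition tensor_scale ::
  "'k::times \<Rightarrow> ('x \<Rightarrow> 'y \<Rightarrow> 'k) \<Rightarrow> 'x \<Rightarrow> 'y \<Rightarrow> 'k" where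
  "tensor_scale c t = (\<lambda>\<xi> \<eta>. c * t \<xi> \<eta>)"

definition pure_tensor ::
  "('k::field \<Rightarrow> 'v::ab_group_add \<Rightarrow> 'v) \<Rightarrow> 'v set \<Rightarrow> 'v \<Rightarrow> 'v \<Rightarrow> ('v \<Rightarrow> 'k) \<Rightarrow> ('v \<Rightarrow> 'k) \<Rightarrow> 'k" where
  "pure_tensor s V x y = (\<lambda>\<xi> \<eta>. bidual_embed s V x \<xi> * bidual_embed s V y \<eta>)"

definition tensor_map ::
  "('k::field \<Rightarrow> 'v::ab_group_add \<Rightarrow> 'v) \<Rightarrow> 'v set \<Rightarrow> ('v \<Rightarrow> 'v) \<Rightarrow> ('v \<Rightarrow> 'v) \<Rightarrow>
   (('v \<Rightarrow> 'k) \<Rightarrow> ('v \<Rightarrow> 'k) \<Rightarrow> 'k) \<Rightarrow> ('v \<Rightarrow> 'k) \<Rightarrow> ('v \<Rightarrow> 'k) \<Rightarrow> 'k" where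
  "tensor_map s V f g t =
     (\<lambda>\<xi> \<eta>. if \<xi> \<in> dual s V \<and> \<eta> \<in> dual s V then t (transpose_on V f \<xi>) (transpose_on V g \<eta>) else 0)"

lemma linear_onD:
  assumes "linear_on s t V W f"
  shows "x \<in> V \<Longrightarrow> f x \<in> W" "x \<in> V \<Longrightarrow> y \<in> V \<Longrightarrow> f (x + y) = f x + f y"
    "x \<in> V \<Longrightarrow> f (s c x) = t c (f x)"
  using assms by (auto simp: linear_on_def)

lemma bilinear_onD:
  assumes "bilinear_on s t r U V W f"
  shows "x \<in> U \<Longrightarrow> linear_on t r V W (f x)" "y \<in> V \<Longrightarrow> linear_on s r U W (\<lambda>x. f x y)"
  using assms by (auto simp: bilinear_on_def)

lemma vector_space_mult: "vector_space ((*) :: 'k::field \<Rightarrow> 'k \<Rightarrow> 'k)"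
  by unfold_locales (auto simp: algebra_simps)

lemma vector_space_fun_scale: "vector_space (fun_scale :: 'k::field \<Rightarrow> ('x \<Rightarrow> 'k) \<Rightarrow> 'x \<Rightarrow> 'k)"
  by unfold_locales (auto simp: fun_scale_def algebra_simps)

lemma vector_space_tensor_scale:
  "vector_space (tensor_scale :: 'k::field \<Rightarrow> ('x \<Rightarrow> 'y \<Rightarrow> 'k) \<Rightarrow> 'x \<Rightarrow> 'y \<Rightarrow> 'k)"
  by unfold_locales (auto simp: tensor_scale_def fun_eq_iff algebra_simps)

lemma sum_fun_apply: "(\<Sum>i\<in>I. f i) x = (\<Sum>i\<in>I. f i x)"
  by (induction I rule: infinite_finite_induct) auto

lemma linear_on_sum:
  assumes lin: "linear_on s t V W f" and "vector_space s" "module.subspace s V" "vector_space t"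
    and "\<And>i. i \<in> I \<Longrightarrow> g i \<in> V" "finite I"
  shows "f (\<Sum>i\<in>I. s (c i) (g i)) = (\<Sum>i\<in>I. t (c i) (f (g i)))"
proof -
  interpret s: vector_space s by fact
  interpret t: vector_space t by fact
  have f0: "f 0 = 0"
    using linear_onD(3)[OF lin s.subspace_0[OF assms(3)], of 0] by simp
  show ?thesis using \<open>finite I\<close> assms(5)
  proof (induction I rule: finite_induct)
    case (insert i I)
    have "(\<Sum>i\<in>I. s (c i) (g i)) \<in> V" "s (c i) (g i) \<in> V"
      using insert.prems by (auto intro!: s.subspace_sum s.subspace_scale assms(3))
    then show ?case
      using insert linear_onD(2)[OF lin] linear_onD(3)[OF lin] by simp
  qed (simp add: f0)
qed

context fd_vspace
begin

lemma finite_basis: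
  obtains B where "finite B" "independent B" "span B = V"
proof -
  obtain C where C: "finite C" "span C = V" using finitely_spanned by blast
  obtain B where B: "B \<subseteq> C" "independent B" "C \<subseteq> span B"
    using maximal_independent_subset by blast
  have "span B = V"
    using C(2) span_mono[OF B(1)] span_minimal[OF B(3) subspace_span] by simp
  then show ?thesis using that[OF finite_subset[OF B(1) C(1)] B(2)] by simp
qed

lemma subspace_V: "subspace V"
  using finitely_spanned subspace_span by auto

lemma coordinate_in_dual:
  assumes "independent B" "span B = V"
  shows "(\<lambda>v. representation B v b) \<in> dual scale V"
proof -
  have "representation B v b = 0" if "v \<notin> V" for v
    unfolding representation_def assms(2) using that by simp
  then show ?thesis
    using representation_add[OF assms(1)] representation_scale[OF assms(1)]
    by (simp add: dual_def linear_on_def assms(2))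
qed

lemma subspace_dual: "module.subspace fun_scale (dual scale V)"
proof -
  interpret f: vector_space "fun_scale :: 'k \<Rightarrow> ('v \<Rightarrow> 'k) \<Rightarrow> 'v \<Rightarrow> 'k"
    by (rule vector_space_fun_scale)
  show ?thesis
    by (rule f.subspaceI) (auto simp: dual_def linear_on_def fun_scale_def algebra_simps)
qed

lemma subspace_tensor_square: "module.subspace tensor_scale (tensor_square scale V)"
proof -
  interpret f: vector_space "tensor_scale :: 'k \<Rightarrow> (('v \<Rightarrow> 'k) \<Rightarrow> ('v \<Rightarrow> 'k) \<Rightarrow> 'k) \<Rightarrow> _"
    by (rule vector_space_tensor_scale)
  show ?thesis
    by (rule f.subspaceI)
      (auto simp: tensor_square_def bilinear_on_def linear_on_def tensor_scale_def fun_scale_def algebra_simps)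
qed

lemma dual_expansion:
  assumes "finite B" "independent B" "span B = V" "\<xi> \<in> dual scale V"
  shows "\<xi> = (\<Sum>b\<in>B. fun_scale (\<xi> b) (\<lambda>v. representation B v b))"
proof
  fix v
  have lin: "linear_on scale (*) V UNIV \<xi>" using assms(4) by (simp add: dual_def)
  show "\<xi> v = (\<Sum>b\<in>B. fun_scale (\<xi> b) (\<lambda>v. representation B v b)) v"
  proof (cases "v \<in> V")
    case True
    then have "(\<Sum>b\<in>B. scale (representation B v b) b) = v"
      using assms sum_representation_eq[of B v B] by blast
    then have "\<xi> v = \<xi> (\<Sum>b\<in>B. scale (representation B v b) b)" by simp
    also have "\<dots> = (\<Sum>b\<in>B. representation B v b * \<xi> b)"
      using assms span_superset[of B]
      by (intro linear_on_sum[OF lin vector_space_axioms subspace_V vector_space_mult]) auto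
    finally show ?thesis
      by (simp add: sum_fun_apply fun_scale_def mult.commute)
  next
    case False
    then show ?thesis using assms
      by (auto simp: sum_fun_apply fun_scale_def dual_def representation_def)
  qed
qed

lemma dual_separates:
  assumes "x \<in> V" "y \<in> V" "\<And>\<xi>. \<xi> \<in> dual scale V \<Longrightarrow> \<xi> x = \<xi> y"
  shows "x = y"
proof -
  obtain B where B: "finite B" "independent B" "span B = V" by (rule finite_basis)
  have "representation B x b = representation B y b" for b
    using assms(3)[OF coordinate_in_dual[OF B(2,3)]] .
  then have "(\<Sum>b\<in>B. scale (representation B x b) b) = (\<Sum>b\<in>B. scale (representation B y b) b)"
    by simp
  then show ?thesis using assms B sum_representation_eq[of B _ B] by auto
qed

lemma bidual_embed_bij: "bij_betw (bidual_embed scale V) V (dual fun_scale (dual scale V))"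
proof (intro bij_betw_imageI inj_onI equalityI subsetI)
  fix x y assume "x \<in> V" "y \<in> V" "bidual_embed scale V x = bidual_embed scale V y"
  then show "x = y"
    by (intro dual_separates) (auto simp: bidual_embed_def fun_eq_iff split: if_splits)
next
  fix X assume "X \<in> bidual_embed scale V ` V"
  then obtain x where x: "x \<in> V" "X = bidual_embed scale V x" by blast
  interpret f: vector_space "fun_scale :: 'k \<Rightarrow> ('v \<Rightarrow> 'k) \<Rightarrow> 'v \<Rightarrow> 'k"
    by (rule vector_space_fun_scale)
  show "X \<in> dual fun_scale (dual scale V)"
    using f.subspace_add[OF subspace_dual] f.subspace_scale[OF subspace_dual] x
    by (auto simp: dual_def[of fun_scale] linear_on_def bidual_embed_def)
       (auto simp: fun_scale_def)
next
  fix X assume X: "X \<in> dual fun_scale (dual scale V)"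
  then have lin: "linear_on fun_scale (*) (dual scale V) UNIV X" by (simp add: dual_def[of fun_scale])
  obtain B where B: "finite B" "independent B" "span B = V" by (rule finite_basis)
  define x where "x = (\<Sum>b\<in>B. scale (X (\<lambda>v. representation B v b)) b)"
  have x: "x \<in> V"
    unfolding x_def using B span_superset[of B]
    by (intro subspace_sum[OF subspace_V] subspace_scale[OF subspace_V]) blast
  note vs = vector_space_mult
  have "X \<xi> = \<xi> x" if xi: "\<xi> \<in> dual scale V" for \<xi>
  proof -
    have "X \<xi> = X (\<Sum>b\<in>B. fun_scale (\<xi> b) (\<lambda>v. representation B v b))"
      using dual_expansion[OF B xi] by simp
    also have "\<dots> = (\<Sum>b\<in>B. \<xi> b * X (\<lambda>v. representation B v b))"
      using B coordinate_in_dual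
      by (intro linear_on_sum[OF lin vector_space_fun_scale subspace_dual vs]) auto
    also have "\<dots> = (\<Sum>b\<in>B. X (\<lambda>v. representation B v b) * \<xi> b)"
      by (simp add: mult.commute)
    also have "\<dots> = \<xi> x"
      unfolding x_def using xi B span_superset[of B]
      by (intro linear_on_sum[symmetric, OF _ vector_space_axioms subspace_V vs])
         (auto simp: dual_def)
    finally show ?thesis .
  qed
  then have "X = bidual_embed scale V x"
    using X by (auto simp: bidual_embed_def dual_def[of fun_scale])
  then show "X \<in> bidual_embed scale V ` V" using x by blast
qed

lemma pure_tensor_bilinear:
  "bilinear_on scale scale tensor_scale V V (tensor_square scale V) (pure_tensor scale V)"
proof -
  interpret f: vector_space "fun_scale :: 'k \<Rightarrow> ('v \<Rightarrow> 'k) \<Rightarrow> 'v \<Rightarrow> 'k"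
    by (rule vector_space_fun_scale)
  have "pure_tensor scale V x y \<in> tensor_square scale V" if "x \<in> V" "y \<in> V" for x y
    using f.subspace_add[OF subspace_dual] f.subspace_scale[OF subspace_dual]
    by (auto simp: tensor_square_def bilinear_on_def linear_on_def pure_tensor_def bidual_embed_def)
       (auto simp: fun_scale_def algebra_simps)
  moreover have "bidual_embed scale V (x + y) = bidual_embed scale V x + bidual_embed scale V y"
    "bidual_embed scale V (scale c x) = fun_scale c (bidual_embed scale V x)"
    if "x \<in> V" "y \<in> V" for x y c
    using that by (auto simp: bidual_embed_def dual_def linear_on_def fun_scale_def fun_eq_iff)
  ultimately show ?thesis
    by (auto simp: bilinear_on_def linear_on_def)
       (auto simp: pure_tensor_def fun_scale_def tensor_scale_def fun_eq_iff algebra_simps)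
qed

lemma tensor_expansion:
  assumes B: "finite B" "independent B" "span B = V" and t: "t \<in> tensor_square scale V"
  shows "t = (\<Sum>b\<in>B. \<Sum>c\<in>B. tensor_scale
    (t (\<lambda>v. representation B v b) (\<lambda>v. representation B v c)) (pure_tensor scale V b c))"
    (is "_ = ?R")
proof (intro ext)
  fix \<xi> \<eta>
  let ?e = "\<lambda>b v. representation B v b"
  have bil: "bilinear_on fun_scale fun_scale (*) (dual scale V) (dual scale V) UNIV t"
    using t by (simp add: tensor_square_def)
  have e: "?e b \<in> dual scale V" for b using B coordinate_in_dual by blast
  note vs = vector_space_mult
  have R: "?R \<xi> \<eta> = (\<Sum>b\<in>B. \<Sum>c\<in>B. t (?e b) (?e c) * pure_tensor scale V b c \<xi> \<eta>)"
    by (simp add: sum_fun_apply tensor_scale_def)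
  show "t \<xi> \<eta> = ?R \<xi> \<eta>"
  proof (cases "\<xi> \<in> dual scale V \<and> \<eta> \<in> dual scale V")
    case True
    have "t \<xi> \<eta> = t (\<Sum>b\<in>B. fun_scale (\<xi> b) (?e b)) \<eta>"
      using dual_expansion[OF B] True by metis
    also have "\<dots> = (\<Sum>b\<in>B. \<xi> b * t (?e b) \<eta>)"
      using True B e
      by (intro linear_on_sum[OF bilinear_onD(2)[OF bil] vector_space_fun_scale subspace_dual vs]) auto
    also have "\<dots> = (\<Sum>b\<in>B. \<xi> b * t (?e b) (\<Sum>c\<in>B. fun_scale (\<eta> c) (?e c)))"
      using dual_expansion[OF B] True by metis
    also have "\<dots> = (\<Sum>b\<in>B. \<xi> b * (\<Sum>c\<in>B. \<eta> c * t (?e b) (?e c)))"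
      using True B e
      by (intro sum.cong refl arg_cong[where f = "\<lambda>z. _ * z"]
          linear_on_sum[OF bilinear_onD(1)[OF bil] vector_space_fun_scale subspace_dual vs]) auto
    finally show ?thesis
      unfolding R using True by (simp add: pure_tensor_def bidual_embed_def sum_distrib_left mult_ac)
  next
    case False
    then have "t \<xi> \<eta> = 0" using t by (auto simp: tensor_square_def)
    moreover have "pure_tensor scale V b c \<xi> \<eta> = 0" for b c
      using False by (auto simp: pure_tensor_def bidual_embed_def)
    ultimately show ?thesis by (simp add: R)
  qed
qed

lemma tensor_square_fd: "fd_vspace tensor_scale (tensor_square scale V)"
proof -
  interpret T: vector_space "tensor_scale :: 'k \<Rightarrow> (('v \<Rightarrow> 'k) \<Rightarrow> ('v \<Rightarrow> 'k) \<Rightarrow> 'k) \<Rightarrow> _"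
    by (rule vector_space_tensor_scale)
  obtain B where B: "finite B" "independent B" "span B = V" by (rule finite_basis)
  define P where "P = case_prod (pure_tensor scale V) ` (B \<times> B)"
  have "P \<subseteq> tensor_square scale V"
  proof
    fix p assume "p \<in> P"
    then obtain b c where "b \<in> B" "c \<in> B" "p = pure_tensor scale V b c"
      unfolding P_def by auto
    moreover have "b \<in> V" "c \<in> V"
      using \<open>b \<in> B\<close> \<open>c \<in> B\<close> span_base[of _ B] unfolding B(3) by auto
    ultimately show "p \<in> tensor_square scale V"
      using linear_onD(1)[OF bilinear_onD(1)[OF pure_tensor_bilinear]] by simp
  qed
  then have "T.span P \<subseteq> tensor_square scale V"
    by (rule T.span_minimal[OF _ subspace_tensor_square])
  moreover have "t \<in> T.span P" if "t \<in> tensor_square scale V" for t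
  proof -
    have "pure_tensor scale V b c \<in> P" if "b \<in> B" "c \<in> B" for b c
      using that by (auto simp: P_def)
    then show ?thesis
      by (subst tensor_expansion[OF B that]) (intro T.span_sum T.span_scale T.span_base)
  qed
  ultimately have "T.span P = tensor_square scale V" by blast
  moreover have "finite P" using B(1) by (simp add: P_def)
  ultimately show ?thesis by unfold_locales blast
qed

lemma tensor_map_pure:
  assumes "linear_on scale scale V V f" "linear_on scale scale V V g" "x \<in> V" "y \<in> V"
  shows "tensor_map scale V f g (pure_tensor scale V x y) = pure_tensor scale V (f x) (g y)"
proof -
  have "transpose_on V h \<xi> \<in> dual scale V"
    if "linear_on scale scale V V h" "\<xi> \<in> dual scale V" for h \<xi>
    using that subspace_add[OF subspace_V] subspace_scale[OF subspace_V]
    by (auto simp: dual_def linear_on_def transpose_on_def)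
  then show ?thesis using assms
    by (auto simp: tensor_map_def pure_tensor_def bidual_embed_def transpose_on_def fun_eq_iff)
qed

lemma tensor_lift_exists:
  assumes r: "vector_space r" "module.subspace r W" and F: "bilinear_on scale scale r V V W F"
  shows "\<exists>h. linear_on tensor_scale r (tensor_square scale V) W h \<and>
             (\<forall>x\<in>V. \<forall>y\<in>V. h (pure_tensor scale V x y) = F x y)"
proof -
  interpret r: vector_space r by fact
  obtain B where B: "finite B" "independent B" "span B = V" by (rule finite_basis)
  let ?e = "\<lambda>b v. representation B v b"
  define h where "h t = (\<Sum>b\<in>B. \<Sum>c\<in>B. r (t (?e b) (?e c)) (F b c))" for t
  have BV: "b \<in> V" if "b \<in> B" for b using that B span_superset[of B] by blast
  have e: "?e b \<in> dual scale V" for b using B coordinate_in_dual by blast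
  have FW: "F b c \<in> W" if "b \<in> V" "c \<in> V" for b c
    using linear_onD(1)[OF bilinear_onD(1)[OF F]] that by blast
  have "linear_on tensor_scale r (tensor_square scale V) W h"
    unfolding linear_on_def
  proof (intro conjI ballI allI)
    show "h t \<in> W" for t
      unfolding h_def using BV FW
      by (auto intro!: r.subspace_sum[OF r(2)] r.subspace_scale[OF r(2)])
    show "h (t + u) = h t + h u" for t u
      by (simp add: h_def r.scale_left_distrib sum.distrib)
    show "h (tensor_scale c t) = r c (h t)" for c t
      by (simp add: h_def tensor_scale_def r.scale_sum_right)
  qed
  moreover have "h (pure_tensor scale V x y) = F x y" if xy: "x \<in> V" "y \<in> V" for x y
  proof -
    have ex: "(\<Sum>b\<in>B. scale (?e b z) b) = z" if "z \<in> V" for z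
      using that B sum_representation_eq[of B z B] by blast
    have "F x y = F (\<Sum>b\<in>B. scale (?e b x) b) y" using ex xy by simp
    also have "\<dots> = (\<Sum>b\<in>B. r (?e b x) (F b y))"
      using xy B BV
      by (intro linear_on_sum[OF bilinear_onD(2)[OF F] vector_space_axioms subspace_V r(1)]) auto
    also have "\<dots> = (\<Sum>b\<in>B. r (?e b x) (F b (\<Sum>c\<in>B. scale (?e c y) c)))" using ex xy by simp
    also have "\<dots> = (\<Sum>b\<in>B. r (?e b x) (\<Sum>c\<in>B. r (?e c y) (F b c)))"
      using xy B BV
      by (intro sum.cong refl arg_cong[where f = "\<lambda>z. r _ z"]
          linear_on_sum[OF bilinear_onD(1)[OF F] vector_space_axioms subspace_V r(1)]) auto
    also have "\<dots> = h (pure_tensor scale V x y)"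
      using e by (simp add: h_def pure_tensor_def bidual_embed_def r.scale_sum_right)
    finally show ?thesis by simp
  qed
  ultimately show ?thesis by blast
qed

lemma tensor_lift_unique:
  assumes r: "vector_space r"
    and h: "linear_on tensor_scale r (tensor_square scale V) W h"
      "linear_on tensor_scale r (tensor_square scale V) W h'"
    and eq: "\<And>x y. \<lbrakk>x \<in> V; y \<in> V\<rbrakk> \<Longrightarrow> h (pure_tensor scale V x y) = h' (pure_tensor scale V x y)"
    and t: "t \<in> tensor_square scale V"
  shows "h t = h' t"
proof -
  obtain B where B: "finite B" "independent B" "span B = V" by (rule finite_basis)
  have BV: "b \<in> V" if "b \<in> B" for b using that B span_superset[of B] by blast
  let ?e = "\<lambda>b v. representation B v b"
  have t': "t = (\<Sum>p\<in>B\<times>B. tensor_scale (t (?e (fst p)) (?e (snd p)))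
      (pure_tensor scale V (fst p) (snd p)))"
    by (subst tensor_expansion[OF B t]) (simp add: sum.cartesian_product split_def)
  have mem: "pure_tensor scale V b c \<in> tensor_square scale V" if "b \<in> V" "c \<in> V" for b c
    using linear_onD(1)[OF bilinear_onD(1)[OF pure_tensor_bilinear]] that by blast
  have *: "k t = (\<Sum>p\<in>B\<times>B. r (t (?e (fst p)) (?e (snd p)))
      (k (pure_tensor scale V (fst p) (snd p))))"
    if "linear_on tensor_scale r (tensor_square scale V) W k" for k
    apply (subst t')
    apply (rule linear_on_sum[OF that vector_space_tensor_scale subspace_tensor_square r])
    using B BV mem by auto
  show ?thesis
    unfolding *[OF h(1)] *[OF h(2)] using BV eq by (intro sum.cong) auto
qed

end



section \<open>Hom-Lie algebras\<close>

locale hom_lie_algebra = fd_vspace scale G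
  for scale :: "'k::field \<Rightarrow> 'v::ab_group_add \<Rightarrow> 'v" and G :: "'v set" +
  fixes bracket :: "'v \<Rightarrow> 'v \<Rightarrow> 'v" and \<phi> :: "'v \<Rightarrow> 'v"
  assumes bracket_bilinear: "bilinear_on scale scale scale G G G bracket"
    and twist_linear: "linear_on scale scale G G \<phi>"
    and bracket_skew: "\<lbrakk>x \<in> G; y \<in> G\<rbrakk> \<Longrightarrow> bracket x y = - bracket y x"
    and twist_bracket: "\<lbrakk>x \<in> G; y \<in> G\<rbrakk> \<Longrightarrow> \<phi> (bracket x y) = bracket (\<phi> x) (\<phi> y)"
    and hom_jacobi: "\<lbrakk>x \<in> G; y \<in> G; z \<in> G\<rbrakk> \<Longrightarrow>
      bracket (\<phi> x) (bracket y z) + bracket (\<phi> y) (bracket z x) + bracket (\<phi> z) (bracket x y) = 0"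

locale hom_lie_representation =
  hom_lie_algebra sG G bracket \<phi> + rep: fd_vspace sV V
  for sG :: "'k::field \<Rightarrow> 'g::ab_group_add \<Rightarrow> 'g" and G bracket \<phi>
    and sV :: "'k \<Rightarrow> 'v::ab_group_add \<Rightarrow> 'v" and V +
  fixes \<beta> :: "'v \<Rightarrow> 'v" and \<rho> :: "'g \<Rightarrow> 'v \<Rightarrow> 'v"
  assumes beta_linear: "linear_on sV sV V V \<beta>"
    and rho_linear: "bilinear_on sG sV sV G V V \<rho>"
    and rho_beta: "\<lbrakk>x \<in> G; v \<in> V\<rbrakk> \<Longrightarrow> \<rho> (\<phi> x) (\<beta> v) = \<beta> (\<rho> x v)"
    and rho_bracket: "\<lbrakk>x \<in> G; y \<in> G; v \<in> V\<rbrakk> \<Longrightarrow>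
      \<rho> (bracket x y) (\<beta> v) = \<rho> (\<phi> x) (\<rho> y v) - \<rho> (\<phi> y) (\<rho> x v)"

locale hom_lie_cocycle =
  hom_lie_representation sG G bracket \<phi> sV V \<beta> \<rho>
  for sG :: "'k::field \<Rightarrow> 'g::ab_group_add \<Rightarrow> 'g" and G bracket \<phi>
    and sV :: "'k \<Rightarrow> 'v::ab_group_add \<Rightarrow> 'v" and V \<beta> \<rho> +
  fixes \<delta> :: "'g \<Rightarrow> 'v"
  assumes cocycle_linear: "linear_on sG sV G V \<delta>"
    and cocycle: "\<lbrakk>x \<in> G; y \<in> G\<rbrakk> \<Longrightarrow>
      \<delta> (bracket x y) = \<rho> (\<phi> x) (\<delta> y) - \<rho> (\<phi> y) (\<delta> x)"


section \<open>Hom-pre-Lie algebras\<close>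

definition commutator :: "('v \<Rightarrow> 'v \<Rightarrow> 'v::minus) \<Rightarrow> 'v \<Rightarrow> 'v \<Rightarrow> 'v" where
  "commutator m x y = m x y - m y x"

definition right_mult :: "('v \<Rightarrow> 'v \<Rightarrow> 'v) \<Rightarrow> 'v \<Rightarrow> 'v \<Rightarrow> 'v" where
  "right_mult m x y = m y x"

locale hom_pre_lie_algebra = fd_vspace scale A
  for scale :: "'k::field \<Rightarrow> 'v::ab_group_add \<Rightarrow> 'v" and A :: "'v set" +
  fixes mult :: "'v \<Rightarrow> 'v \<Rightarrow> 'v" (infixl \<open>\<cdot>\<close> 70) and \<alpha> :: "'v \<Rightarrow> 'v"
  assumes mult_bilinear: "bilinear_on scale scale scale A A A mult"
    and alpha_linear: "linear_on scale scale A A \<alpha>"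
    and alpha_mult: "\<lbrakk>x \<in> A; y \<in> A\<rbrakk> \<Longrightarrow> \<alpha> (x \<cdot> y) = \<alpha> x \<cdot> \<alpha> y"
    and hom_pre_lie: "\<lbrakk>x \<in> A; y \<in> A; z \<in> A\<rbrakk> \<Longrightarrow>
      (x \<cdot> y) \<cdot> \<alpha> z - \<alpha> x \<cdot> (y \<cdot> z) = (y \<cdot> x) \<cdot> \<alpha> z - \<alpha> y \<cdot> (x \<cdot> z)"

locale regular_hom_pre_lie_algebra = hom_pre_lie_algebra +
  assumes regular: "bij_betw \<alpha> A A"

locale hom_pre_lie_representation =
  regular_hom_pre_lie_algebra sA A mult \<alpha> +
  hom_lie_representation sA A "commutator mult" \<alpha> sV V \<beta> \<rho>
  for sA :: "'k::field \<Rightarrow> 'a::ab_group_add \<Rightarrow> 'a" and A and mult (infixl \<open>\<cdot>\<close> 70) and \<alpha>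
    and sV :: "'k \<Rightarrow> 'v::ab_group_add \<Rightarrow> 'v" and V \<beta> \<rho> +
  fixes \<mu> :: "'a \<Rightarrow> 'v \<Rightarrow> 'v"
  assumes mu_linear: "bilinear_on sA sV sV A V V \<mu>"
    and beta_mu: "\<lbrakk>x \<in> A; v \<in> V\<rbrakk> \<Longrightarrow> \<beta> (\<mu> x v) = \<mu> (\<alpha> x) (\<beta> v)"
    and mu_mult: "\<lbrakk>x \<in> A; y \<in> A; v \<in> V\<rbrakk> \<Longrightarrow>
      \<mu> (\<alpha> y) (\<mu> x v) - \<mu> (x \<cdot> y) (\<beta> v) = \<mu> (\<alpha> y) (\<rho> x v) - \<rho> (\<alpha> x) (\<mu> y v)"

locale hom_pre_lie_matched_pair =
  repB: hom_pre_lie_representation sA A multA \<alpha>\<^sub>A sB B \<alpha>\<^sub>B l\<^sub>A r\<^sub>A +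
  repA: hom_pre_lie_representation sB B multB \<alpha>\<^sub>B sA A \<alpha>\<^sub>A l\<^sub>B r\<^sub>B
  for sA :: "'k::field \<Rightarrow> 'a::ab_group_add \<Rightarrow> 'a" and A and multA (infixl \<open>\<cdot>\<close> 70) and \<alpha>\<^sub>A
    and sB :: "'k \<Rightarrow> 'b::ab_group_add \<Rightarrow> 'b" and B and multB (infixl \<open>\<odot>\<close> 70) and \<alpha>\<^sub>B
    and l\<^sub>A r\<^sub>A :: "'a \<Rightarrow> 'b \<Rightarrow> 'b" and l\<^sub>B r\<^sub>B :: "'b \<Rightarrow> 'a \<Rightarrow> 'a" +
  assumes matched_rA: "\<lbrakk>x \<in> A; a \<in> B; b \<in> B\<rbrakk> \<Longrightarrow>
      r\<^sub>A (\<alpha>\<^sub>A x) (commutator (\<odot>) a b) =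
        r\<^sub>A (l\<^sub>B b x) (\<alpha>\<^sub>B a) - r\<^sub>A (l\<^sub>B a x) (\<alpha>\<^sub>B b)
        + \<alpha>\<^sub>B a \<odot> r\<^sub>A x b - \<alpha>\<^sub>B b \<odot> r\<^sub>A x a"
    and matched_lA: "\<lbrakk>x \<in> A; a \<in> B; b \<in> B\<rbrakk> \<Longrightarrow>
      l\<^sub>A (\<alpha>\<^sub>A x) (a \<odot> b) =
        - l\<^sub>A (l\<^sub>B a x - r\<^sub>B a x) (\<alpha>\<^sub>B b) + (l\<^sub>A x a - r\<^sub>A x a) \<odot> \<alpha>\<^sub>B b
        + r\<^sub>A (r\<^sub>B b x) (\<alpha>\<^sub>B a) + \<alpha>\<^sub>B a \<odot> l\<^sub>A x b"
    and matched_rB: "\<lbrakk>x \<in> A; y \<in> A; a \<in> B\<rbrakk> \<Longrightarrow>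
      r\<^sub>B (\<alpha>\<^sub>B a) (commutator (\<cdot>) x y) =
        r\<^sub>B (l\<^sub>A y a) (\<alpha>\<^sub>A x) - r\<^sub>B (l\<^sub>A x a) (\<alpha>\<^sub>A y)
        + \<alpha>\<^sub>A x \<cdot> r\<^sub>B a y - \<alpha>\<^sub>A y \<cdot> r\<^sub>B a x"
    and matched_lB: "\<lbrakk>x \<in> A; y \<in> A; a \<in> B\<rbrakk> \<Longrightarrow>
      l\<^sub>B (\<alpha>\<^sub>B a) (x \<cdot> y) =
        - l\<^sub>B (l\<^sub>A x a - r\<^sub>A x a) (\<alpha>\<^sub>A y) + (l\<^sub>B a x - r\<^sub>B a x) \<cdot> \<alpha>\<^sub>A y
        + r\<^sub>B (r\<^sub>A y a) (\<alpha>\<^sub>A x) + \<alpha>\<^sub>A x \<cdot> l\<^sub>B a y"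


section \<open>Quadratic Hom-pre-Lie algebras and Manin triples\<close>

locale quadratic_hom_pre_lie_algebra =
  regular_hom_pre_lie_algebra scale A mult \<alpha>
  for scale :: "'k::field \<Rightarrow> 'v::ab_group_add \<Rightarrow> 'v" and A and mult (infixl \<open>\<cdot>\<close> 70) and \<alpha> +
  fixes \<omega> :: "'v \<Rightarrow> 'v \<Rightarrow> 'k"
  assumes form_bilinear: "bilinear_on scale scale (*) A A UNIV \<omega>"
    and form_nondegenerate: "\<lbrakk>x \<in> A; \<forall>y\<in>A. \<omega> x y = 0\<rbrakk> \<Longrightarrow> x = 0"
    and form_skew: "\<lbrakk>x \<in> A; y \<in> A\<rbrakk> \<Longrightarrow> \<omega> x y = - \<omega> y x"
    and form_alpha: "\<lbrakk>x \<in> A; y \<in> A\<rbrakk> \<Longrightarrow> \<omega> (\<alpha> x) (\<alpha> y) = \<omega> x y"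
    and form_invariant: "\<lbrakk>x \<in> A; y \<in> A; z \<in> A\<rbrakk> \<Longrightarrow>
      \<omega> (x \<cdot> y) (\<alpha> z) = - \<omega> (\<alpha> y) (commutator (\<cdot>) x z)"

text \<open>
  The structures \<open>(A\<^sub>i, mult\<^sub>i, \<alpha>\<^sub>i)\<close> are given on subsets \<open>A\<^sub>i\<close> of the big algebra; the agreement of
  \<open>\<alpha>\<^sub>i\<close> with \<open>\<alpha>\<close> on \<open>A\<^sub>i\<close> is part of \<open>\<alpha> = \<alpha>\<^sub>1 \<oplus> \<alpha>\<^sub>2\<close>.
\<close>

locale hom_pre_lie_manin_triple =
  quadratic_hom_pre_lie_algebra scale A mult \<alpha> \<omega> +
  sub1: regular_hom_pre_lie_algebra scale A\<^sub>1 mult\<^sub>1 \<alpha>\<^sub>1 +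
  sub2: regular_hom_pre_lie_algebra scale A\<^sub>2 mult\<^sub>2 \<alpha>\<^sub>2
  for scale :: "'k::field \<Rightarrow> 'v::ab_group_add \<Rightarrow> 'v" and A and mult (infixl \<open>\<cdot>\<close> 70) and \<alpha> \<omega>
    and A\<^sub>1 mult\<^sub>1 \<alpha>\<^sub>1 and A\<^sub>2 mult\<^sub>2 \<alpha>\<^sub>2 +
  assumes sub1_mult: "\<lbrakk>x \<in> A\<^sub>1; y \<in> A\<^sub>1\<rbrakk> \<Longrightarrow> mult\<^sub>1 x y = x \<cdot> y"
    and sub2_mult: "\<lbrakk>x \<in> A\<^sub>2; y \<in> A\<^sub>2\<rbrakk> \<Longrightarrow> mult\<^sub>2 x y = x \<cdot> y"
    and isotropic1: "\<lbrakk>x \<in> A\<^sub>1; y \<in> A\<^sub>1\<rbrakk> \<Longrightarrow> \<omega> x y = 0"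
    and isotropic2: "\<lbrakk>x \<in> A\<^sub>2; y \<in> A\<^sub>2\<rbrakk> \<Longrightarrow> \<omega> x y = 0"
    and direct_sum: "A = {x + y | x y. x \<in> A\<^sub>1 \<and> y \<in> A\<^sub>2}" "A\<^sub>1 \<inter> A\<^sub>2 = {0}"
    and alpha_sum: "\<lbrakk>x \<in> A\<^sub>1; y \<in> A\<^sub>2\<rbrakk> \<Longrightarrow> \<alpha> (x + y) = \<alpha>\<^sub>1 x + \<alpha>\<^sub>2 y"


section \<open>Coadjoint-type operators\<close>

text \<open>\<open>M*\<close> for a linear map \<open>M : A \<rightarrow> gl(A)\<close>, and \<open>M\<^sup>\<star>\<close>, which is twisted by \<open>\<alpha>\<close>.\<close>

definition coadj :: "'a set \<Rightarrow> ('a \<Rightarrow> 'a \<Rightarrow> 'a) \<Rightarrow> 'a \<Rightarrow> ('a \<Rightarrow> 'k::group_add) \<Rightarrow> 'a \<Rightarrow> 'k" where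
  "coadj A M x \<xi> = (\<lambda>y. if y \<in> A then - \<xi> (M x y) else 0)"

definition coadj_star ::
  "'a set \<Rightarrow> ('a \<Rightarrow> 'a) \<Rightarrow> ('a \<Rightarrow> 'a \<Rightarrow> 'a) \<Rightarrow> 'a \<Rightarrow> ('a \<Rightarrow> 'k::group_add) \<Rightarrow> 'a \<Rightarrow> 'k" where
  "coadj_star A \<alpha> M x \<xi> = coadj A M (\<alpha> x) (transpose_on A (inv_into A \<alpha> ^^ 2) \<xi>)"

text \<open>
  The same for a linear map \<open>M : A* \<rightarrow> gl(A*)\<close>. Here \<open>M* \<xi>\<close> is an operator on \<open>A\<close>, not on \<open>A**\<close>:
  its value at \<open>x\<close> is the unique element of \<open>A\<close> on which each functional \<open>\<eta>\<close> takes the value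
  prescribed by \<open>\<langle>M*\<^sub>\<xi> x, \<eta>\<rangle> = - \<langle>x, M\<^sub>\<xi> \<eta>\<rangle>\<close>.
\<close>

definition dual_coadj ::
  "('k::field \<Rightarrow> 'a::ab_group_add \<Rightarrow> 'a) \<Rightarrow> 'a set \<Rightarrow>
   (('a \<Rightarrow> 'k) \<Rightarrow> ('a \<Rightarrow> 'k) \<Rightarrow> ('a \<Rightarrow> 'k)) \<Rightarrow> ('a \<Rightarrow> 'k) \<Rightarrow> 'a \<Rightarrow> 'a" where
  "dual_coadj s A M \<xi> x = (THE y. y \<in> A \<and> (\<forall>\<eta>\<in>dual s A. \<eta> y = - (M \<xi> \<eta> x)))"

lemma (in fd_vspace) dual_coadj:
  assumes M: "linear_on fun_scale fun_scale (dual scale V) (dual scale V) (M \<xi>)" and x: "x \<in> V"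
  shows "dual_coadj scale V M \<xi> x \<in> V"
    and "\<eta> \<in> dual scale V \<Longrightarrow> \<eta> (dual_coadj scale V M \<xi> x) = - (M \<xi> \<eta> x)"
proof -
  interpret f: vector_space "fun_scale :: 'k \<Rightarrow> ('v \<Rightarrow> 'k) \<Rightarrow> _"
    by (rule vector_space_fun_scale)
  define X where "X = (\<lambda>\<eta>. if \<eta> \<in> dual scale V then - (M \<xi> \<eta> x) else 0)"
  have "X \<in> dual fun_scale (dual scale V)"
    using linear_onD(2,3)[OF M] f.subspace_add[OF subspace_dual] f.subspace_scale[OF subspace_dual]
    by (auto simp: X_def dual_def[of fun_scale] linear_on_def) (auto simp: fun_scale_def)
  then obtain y where y: "y \<in> V" "bidual_embed scale V y = X"
    using bij_betw_imp_surj_on[OF bidual_embed_bij] by (metis imageE)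
  then have "\<eta> y = - (M \<xi> \<eta> x)" if "\<eta> \<in> dual scale V" for \<eta>
    using that by (auto simp: X_def bidual_embed_def fun_eq_iff split: if_splits)
  with y(1) have "\<exists>!y. y \<in> V \<and> (\<forall>\<eta>\<in>dual scale V. \<eta> y = - (M \<xi> \<eta> x))"
    by (metis dual_separates)
  from theI'[OF this] show "dual_coadj scale V M \<xi> x \<in> V"
    and "\<eta> \<in> dual scale V \<Longrightarrow> \<eta> (dual_coadj scale V M \<xi> x) = - (M \<xi> \<eta> x)"
    by (auto simp: dual_coadj_def)
qed

definition dual_coadj_star ::
  "('k::field \<Rightarrow> 'a::ab_group_add \<Rightarrow> 'a) \<Rightarrow> 'a set \<Rightarrow> ('a \<Rightarrow> 'a) \<Rightarrow>
   (('a \<Rightarrow> 'k) \<Rightarrow> ('a \<Rightarrow> 'k) \<Rightarrow> ('a \<Rightarrow> 'k)) \<Rightarrow> ('a \<Rightarrow> 'k) \<Rightarrow> 'a \<Rightarrow> 'a" where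
  "dual_coadj_star s A \<alpha> M \<xi> x =
     dual_coadj s A M (transpose_on A (inv_into A \<alpha>) \<xi>) ((\<alpha> ^^ 2) x)"


section \<open>Hom-pre-Lie bialgebras\<close>

text \<open>
  \<open>\<phi>* : A \<rightarrow> A \<otimes> A\<close> and \<open>\<psi>* : A* \<rightarrow> A* \<otimes> A*\<close>. The pairing of an element of \<open>A* \<otimes> A*\<close> with \<open>x \<otimes> y\<close>
  uses \<open>A = A**\<close>.
\<close>

definition coproduct ::
  "('k::field \<Rightarrow> 'a::ab_group_add \<Rightarrow> 'a) \<Rightarrow> 'a set \<Rightarrow>
   (('a \<Rightarrow> 'k) \<Rightarrow> ('a \<Rightarrow> 'k) \<Rightarrow> ('a \<Rightarrow> 'k)) \<Rightarrow> 'a \<Rightarrow> ('a \<Rightarrow> 'k) \<Rightarrow> ('a \<Rightarrow> 'k) \<Rightarrow> 'k" where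
  "coproduct s A circ x =
     (THE t. t \<in> tensor_square s A \<and> (\<forall>\<xi>\<in>dual s A. \<forall>\<eta>\<in>dual s A. t \<xi> \<eta> = circ \<xi> \<eta> x))"

definition dual_coproduct ::
  "('k::field \<Rightarrow> 'a::ab_group_add \<Rightarrow> 'a) \<Rightarrow> 'a set \<Rightarrow> ('a \<Rightarrow> 'a \<Rightarrow> 'a) \<Rightarrow>
   ('a \<Rightarrow> 'k) \<Rightarrow> (('a \<Rightarrow> 'k) \<Rightarrow> 'k) \<Rightarrow> (('a \<Rightarrow> 'k) \<Rightarrow> 'k) \<Rightarrow> 'k" where
  "dual_coproduct s A mult \<xi> =
     (THE t. t \<in> tensor_square fun_scale (dual s A) \<and>
        (\<forall>x\<in>A. \<forall>y\<in>A. t (bidual_embed s A x) (bidual_embed s A y) = \<xi> (mult x y)))"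

lemma (in fd_vspace) coproduct:
  assumes "bilinear_on fun_scale fun_scale fun_scale (dual scale V) (dual scale V) (dual scale V) circ"
  shows "coproduct scale V circ x \<in> tensor_square scale V"
    and "\<lbrakk>\<xi> \<in> dual scale V; \<eta> \<in> dual scale V\<rbrakk> \<Longrightarrow> coproduct scale V circ x \<xi> \<eta> = circ \<xi> \<eta> x"
proof -
  interpret f: vector_space "fun_scale :: 'k \<Rightarrow> ('v \<Rightarrow> 'k) \<Rightarrow> _"
    by (rule vector_space_fun_scale)
  define t where
    "t = (\<lambda>\<xi> \<eta>. if \<xi> \<in> dual scale V \<and> \<eta> \<in> dual scale V then circ \<xi> \<eta> x else 0)"
  have "t \<in> tensor_square scale V"
    using assms f.subspace_add[OF subspace_dual] f.subspace_scale[OF subspace_dual]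
    by (auto simp: t_def tensor_square_def bilinear_on_def linear_on_def) (auto simp: fun_scale_def)
  then have "\<exists>!t. t \<in> tensor_square scale V \<and>
      (\<forall>\<xi>\<in>dual scale V. \<forall>\<eta>\<in>dual scale V. t \<xi> \<eta> = circ \<xi> \<eta> x)"
    by (intro ex1I[of _ t]) (auto simp: t_def tensor_square_def fun_eq_iff)
  from theI'[OF this] show "coproduct scale V circ x \<in> tensor_square scale V"
    and "\<lbrakk>\<xi> \<in> dual scale V; \<eta> \<in> dual scale V\<rbrakk> \<Longrightarrow> coproduct scale V circ x \<xi> \<eta> = circ \<xi> \<eta> x"
    by (auto simp: coproduct_def)
qed

lemma (in fd_vspace) dual_coproduct:
  assumes m: "bilinear_on scale scale scale V V V m" and \<xi>: "\<xi> \<in> dual scale V"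
  shows "dual_coproduct scale V m \<xi> \<in> tensor_square fun_scale (dual scale V)"
    and "\<lbrakk>x \<in> V; y \<in> V\<rbrakk> \<Longrightarrow>
      dual_coproduct scale V m \<xi> (bidual_embed scale V x) (bidual_embed scale V y) = \<xi> (m x y)"
proof -
  let ?e = "bidual_embed scale V"
  let ?DD = "dual fun_scale (dual scale V)"
  let ?i = "inv_into V ?e"
  define t where "t = (\<lambda>X Y. if X \<in> ?DD \<and> Y \<in> ?DD then \<xi> (m (?i X) (?i Y)) else 0)"
  note add = subspace_add[OF subspace_V] and scl = subspace_scale[OF subspace_V]
  have img: "?DD = ?e ` V" and inj: "inj_on ?e V"
    using bidual_embed_bij by (auto simp: bij_betw_def)
  have i: "?i (?e x) = x" if "x \<in> V" for x using inj that by simp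
  have e_add: "?e x + ?e y = ?e (x + y)" and e_scale: "fun_scale c (?e x) = ?e (scale c x)"
    if "x \<in> V" "y \<in> V" for x y c
    using that by (auto simp: bidual_embed_def dual_def linear_on_def fun_scale_def fun_eq_iff)
  have mV: "m x y \<in> V" if "x \<in> V" "y \<in> V" for x y
    using linear_onD(1)[OF bilinear_onD(1)[OF m]] that by blast
  have lin: "linear_on scale (*) V UNIV \<xi>" using \<xi> by (simp add: dual_def)
  have te: "t (?e x) (?e y) = \<xi> (m x y)" if "x \<in> V" "y \<in> V" for x y
    using that by (simp add: t_def img i)
  have "t \<in> tensor_square fun_scale (dual scale V)"
    unfolding tensor_square_def bilinear_on_def linear_on_def img
    using add scl mV linear_onD[OF lin] linear_onD(2,3)[OF bilinear_onD(1)[OF m]]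
      linear_onD(2,3)[OF bilinear_onD(2)[OF m]]
    by (auto simp: e_add e_scale te) (auto simp: t_def img)
  moreover have "u = v"
    if u: "u \<in> tensor_square fun_scale (dual scale V)" and v: "v \<in> tensor_square fun_scale (dual scale V)"
      and eq: "\<And>x y. \<lbrakk>x \<in> V; y \<in> V\<rbrakk> \<Longrightarrow> u (?e x) (?e y) = v (?e x) (?e y)" for u v
  proof (intro ext)
    fix X Y
    show "u X Y = v X Y"
    proof (cases "X \<in> ?DD \<and> Y \<in> ?DD")
      case True
      then show ?thesis using eq img by auto
    next
      case False
      then show ?thesis using u v by (auto simp: tensor_square_def)
    qed
  qed
  ultimately have "\<exists>!t. t \<in> tensor_square fun_scale (dual scale V) \<and>
      (\<forall>x\<in>V. \<forall>y\<in>V. t (?e x) (?e y) = \<xi> (m x y))"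
    using te by (intro ex1I[of _ t]) auto
  from theI'[OF this] show "dual_coproduct scale V m \<xi> \<in> tensor_square fun_scale (dual scale V)"
    and "\<lbrakk>x \<in> V; y \<in> V\<rbrakk> \<Longrightarrow> dual_coproduct scale V m \<xi> (?e x) (?e y) = \<xi> (m x y)"
    by (auto simp: dual_coproduct_def)
qed

text \<open>
  The operator \<open>L\<^sup>-\<^sup>2\<^sub>x \<otimes> \<alpha> + \<alpha> \<otimes> ad\<^sup>-\<^sup>2\<^sub>x\<close> of a Hom-pre-Lie algebra \<open>(V, m, \<alpha>)\<close> on \<open>V \<otimes> V\<close>,
  where \<open>\<alpha>inv2\<close> stands for \<open>\<alpha>\<^sup>-\<^sup>2\<close>.
\<close>

definition tensor_action ::
  "('k::field \<Rightarrow> 'v::ab_group_add \<Rightarrow> 'v) \<Rightarrow> 'v set \<Rightarrow> ('v \<Rightarrow> 'v \<Rightarrow> 'v) \<Rightarrow> ('v \<Rightarrow> 'v) \<Rightarrow> ('v \<Rightarrow> 'v) \<Rightarrow>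
   'v \<Rightarrow> (('v \<Rightarrow> 'k) \<Rightarrow> ('v \<Rightarrow> 'k) \<Rightarrow> 'k) \<Rightarrow> ('v \<Rightarrow> 'k) \<Rightarrow> ('v \<Rightarrow> 'k) \<Rightarrow> 'k" where
  "tensor_action s V m \<alpha> \<alpha>inv2 x t =
     tensor_map s V (m (\<alpha>inv2 x)) \<alpha> t + tensor_map s V \<alpha> (commutator m (\<alpha>inv2 x)) t"

locale hom_pre_lie_bialgebra =
  regular_hom_pre_lie_algebra scale A mult \<alpha> +
  dual_alg: regular_hom_pre_lie_algebra fun_scale "dual scale A" circ
    "transpose_on A (inv_into A \<alpha>)" +
  coproduct_cocycle: hom_lie_cocycle
    scale A "commutator mult" \<alpha>
    tensor_scale "tensor_square scale A" "tensor_map scale A \<alpha> \<alpha>"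
    "tensor_action scale A mult \<alpha> (inv_into A \<alpha> ^^ 2)"
    "coproduct scale A circ" +
  dual_coproduct_cocycle: hom_lie_cocycle
    fun_scale "dual scale A" "commutator circ" "transpose_on A (inv_into A \<alpha>)"
    tensor_scale "tensor_square fun_scale (dual scale A)"
    "tensor_map fun_scale (dual scale A) (transpose_on A (inv_into A \<alpha>)) (transpose_on A (inv_into A \<alpha>))"
    "tensor_action fun_scale (dual scale A) circ (transpose_on A (inv_into A \<alpha>)) (transpose_on A (\<alpha> ^^ 2))"
    "dual_coproduct scale A mult"
  for scale :: "'k::field \<Rightarrow> 'a::ab_group_add \<Rightarrow> 'a" and A and mult and \<alpha>
    and circ :: "('a \<Rightarrow> 'k) \<Rightarrow> ('a \<Rightarrow> 'k) \<Rightarrow> ('a \<Rightarrow> 'k)"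


section \<open>The double \<open>A \<oplus> A*\<close>\<close>

definition double_mult ::
  "('k::field \<Rightarrow> 'a::ab_group_add \<Rightarrow> 'a) \<Rightarrow> 'a set \<Rightarrow> ('a \<Rightarrow> 'a \<Rightarrow> 'a) \<Rightarrow> ('a \<Rightarrow> 'a) \<Rightarrow>
   (('a \<Rightarrow> 'k) \<Rightarrow> ('a \<Rightarrow> 'k) \<Rightarrow> ('a \<Rightarrow> 'k)) \<Rightarrow>
   'a \<times> ('a \<Rightarrow> 'k) \<Rightarrow> 'a \<times> ('a \<Rightarrow> 'k) \<Rightarrow> 'a \<times> ('a \<Rightarrow> 'k)" where
  "double_mult s A mult \<alpha> circ = (\<lambda>(x, \<xi>) (y, \<eta>).
     (mult x y + dual_coadj_star s A \<alpha> (commutator circ) \<xi> y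
        - dual_coadj_star s A \<alpha> (right_mult circ) \<eta> x,
      circ \<xi> \<eta> + coadj_star A \<alpha> (commutator mult) x \<eta>
        - coadj_star A \<alpha> (right_mult mult) y \<xi>))"

definition double_form :: "'a \<times> ('a \<Rightarrow> 'k::minus) \<Rightarrow> 'a \<times> ('a \<Rightarrow> 'k) \<Rightarrow> 'k" where
  "double_form = (\<lambda>(x, \<xi>) (y, \<eta>). \<xi> y - \<eta> x)"

text \<open>
  The standard Manin triple. \<open>A\<close> and \<open>A*\<close> sit in \<open>A \<oplus> A*\<close> as \<open>A \<times> {0}\<close> and \<open>{0} \<times> A*\<close>, with their
  given structures transported along these embeddings.
\<close>

definition standard_manin_triple ::
  "('k::field \<Rightarrow> 'a::ab_group_add \<Rightarrow> 'a) \<Rightarrow> 'a set \<Rightarrow> ('a \<Rightarrow> 'a \<Rightarrow> 'a) \<Rightarrow> ('a \<Rightarrow> 'a) \<Rightarrow>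
   (('a \<Rightarrow> 'k) \<Rightarrow> ('a \<Rightarrow> 'k) \<Rightarrow> ('a \<Rightarrow> 'k)) \<Rightarrow> bool" where
  "standard_manin_triple s A mult \<alpha> circ \<longleftrightarrow>
     hom_pre_lie_manin_triple (prod_scale s fun_scale)
       (A \<times> dual s A) (double_mult s A mult \<alpha> circ)
       (map_prod \<alpha> (transpose_on A (inv_into A \<alpha>))) double_form
       (A \<times> {0}) (\<lambda>u v. (mult (fst u) (fst v), 0)) (\<lambda>u. (\<alpha> (fst u), 0))
       ({0} \<times> dual s A) (\<lambda>u v. (0, circ (snd u) (snd v)))
       (\<lambda>u. (0, transpose_on A (inv_into A \<alpha>) (snd u)))"

end

theory Submission
  imports Defs
begin

text \<open>
  A regular Hom-pre-Lie algebra is the twist \<open>x \<cdot> y = \<alpha> (x * y)\<close> of a pre-Lie algebra by an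
  automorphism, and all the operators \<open>ad\<^sup>\<star>\<close>, \<open>R\<^sup>\<star>\<close> are twists of the ordinary contragredient
  operators. Untwisting therefore reduces the three conditions to conditions on two pre-Lie algebras
  in duality. Pairing the matched pair equations for \<open>l\<^sub>A\<close> and \<open>r\<^sub>B\<close> with a third element and moving
  every operator to the other side of the pairing yields the same scalar identity, which is the
  cocycle condition for \<open>\<phi>*\<close> evaluated at \<open>\<xi> \<otimes> \<eta>\<close>; exchanging the roles of \<open>A\<close> and \<open>A*\<close> handles
  \<open>l\<^sub>B\<close>, \<open>r\<^sub>A\<close> and \<open>\<psi>*\<close>. The representation conditions hold automatically, and given these, the
  pre-Lie identity of the double is equivalent to the four matched pair equations. The invariance
  of the form is automatic.
\<close>

section \<open>Pre-Lie algebras in duality\<close>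

text \<open>
  \<open>l\<close>, \<open>r\<close> stand for \<open>ad*\<close>, \<open>-R*\<close> of \<open>(V, m)\<close> acting on \<open>W\<close>, and \<open>l'\<close>, \<open>r'\<close> for those of \<open>(W, n)\<close>
  acting on \<open>V\<close>. The assumptions are symmetric in \<open>V\<close> and \<open>W\<close>.
\<close>

locale dual_pre_lie =
  fixes V :: "'v::ab_group_add set" and W :: "'w::ab_group_add set"
    and p :: "'v \<Rightarrow> 'w \<Rightarrow> 'k::ab_group_add"
    and m :: "'v \<Rightarrow> 'v \<Rightarrow> 'v" and n :: "'w \<Rightarrow> 'w \<Rightarrow> 'w"
    and l r :: "'v \<Rightarrow> 'w \<Rightarrow> 'w" and l' r' :: "'w \<Rightarrow> 'v \<Rightarrow> 'v"
  assumes V_closed [simp]: "0 \<in> V" "\<lbrakk>x \<in> V; y \<in> V\<rbrakk> \<Longrightarrow> x + y \<in> V"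
      "\<lbrakk>x \<in> V; y \<in> V\<rbrakk> \<Longrightarrow> x - y \<in> V" "x \<in> V \<Longrightarrow> - x \<in> V"
    and W_closed [simp]: "0 \<in> W" "\<lbrakk>a \<in> W; b \<in> W\<rbrakk> \<Longrightarrow> a + b \<in> W"
      "\<lbrakk>a \<in> W; b \<in> W\<rbrakk> \<Longrightarrow> a - b \<in> W" "a \<in> W \<Longrightarrow> - a \<in> W"
    and op_closed [simp]: "\<lbrakk>x \<in> V; y \<in> V\<rbrakk> \<Longrightarrow> m x y \<in> V" "\<lbrakk>a \<in> W; b \<in> W\<rbrakk> \<Longrightarrow> n a b \<in> W"
      "\<lbrakk>x \<in> V; a \<in> W\<rbrakk> \<Longrightarrow> l x a \<in> W" "\<lbrakk>x \<in> V; a \<in> W\<rbrakk> \<Longrightarrow> r x a \<in> W"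
      "\<lbrakk>x \<in> V; a \<in> W\<rbrakk> \<Longrightarrow> l' a x \<in> V" "\<lbrakk>x \<in> V; a \<in> W\<rbrakk> \<Longrightarrow> r' a x \<in> V"
    and p_add: "\<lbrakk>x \<in> V; y \<in> V; a \<in> W\<rbrakk> \<Longrightarrow> p (x + y) a = p x a + p y a"
      "\<lbrakk>x \<in> V; a \<in> W; b \<in> W\<rbrakk> \<Longrightarrow> p x (a + b) = p x a + p x b"
    and separates: "\<lbrakk>x \<in> V; y \<in> V; \<And>a. a \<in> W \<Longrightarrow> p x a = p y a\<rbrakk> \<Longrightarrow> x = y"
      "\<lbrakk>a \<in> W; b \<in> W; \<And>x. x \<in> V \<Longrightarrow> p x a = p x b\<rbrakk> \<Longrightarrow> a = b"
    and m_add: "\<lbrakk>x \<in> V; y \<in> V; z \<in> V\<rbrakk> \<Longrightarrow> m (x + y) z = m x z + m y z"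
      "\<lbrakk>x \<in> V; y \<in> V; z \<in> V\<rbrakk> \<Longrightarrow> m x (y + z) = m x y + m x z"
    and n_add: "\<lbrakk>a \<in> W; b \<in> W; c \<in> W\<rbrakk> \<Longrightarrow> n (a + b) c = n a c + n b c"
      "\<lbrakk>a \<in> W; b \<in> W; c \<in> W\<rbrakk> \<Longrightarrow> n a (b + c) = n a b + n a c"
    and pre_lie_V: "\<lbrakk>x \<in> V; y \<in> V; z \<in> V\<rbrakk> \<Longrightarrow>
      m (m x y) z - m x (m y z) = m (m y x) z - m y (m x z)"
    and pre_lie_W: "\<lbrakk>a \<in> W; b \<in> W; c \<in> W\<rbrakk> \<Longrightarrow>
      n (n a b) c - n a (n b c) = n (n b a) c - n b (n a c)"
    and p_l: "\<lbrakk>x \<in> V; y \<in> V; a \<in> W\<rbrakk> \<Longrightarrow> p y (l x a) = p (m y x) a - p (m x y) a"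
    and p_r: "\<lbrakk>x \<in> V; y \<in> V; a \<in> W\<rbrakk> \<Longrightarrow> p y (r x a) = p (m y x) a"
    and p_l': "\<lbrakk>x \<in> V; a \<in> W; b \<in> W\<rbrakk> \<Longrightarrow> p (l' a x) b = p x (n b a) - p x (n a b)"
    and p_r': "\<lbrakk>x \<in> V; a \<in> W; b \<in> W\<rbrakk> \<Longrightarrow> p (r' a x) b = p x (n b a)"
begin

text \<open>Every result of this locale becomes available a second time with \<open>V\<close> and
  \<open>W\<close> exchanged, which yields the statements about \<open>l'\<close>, \<open>r'\<close>
  and the second cocycle condition.\<close>

lemma swap: "dual_pre_lie W V (\<lambda>a x. p x a) n m l' r' l r"
  by unfold_locales
    (auto simp: p_add m_add n_add pre_lie_V pre_lie_W p_l p_r p_l' p_r'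
      intro: separates)

lemma p_diff: "\<lbrakk>x \<in> V; y \<in> V; a \<in> W\<rbrakk> \<Longrightarrow> p (x - y) a = p x a - p y a"
  "\<lbrakk>x \<in> V; a \<in> W; b \<in> W\<rbrakk> \<Longrightarrow> p x (a - b) = p x a - p x b"
  using p_add(1)[of "x - y" y] p_add(2)[of x "a - b" b] by simp_all

lemma m_diff: "\<lbrakk>x \<in> V; y \<in> V; z \<in> V\<rbrakk> \<Longrightarrow> m (x - y) z = m x z - m y z"
  "\<lbrakk>x \<in> V; y \<in> V; z \<in> V\<rbrakk> \<Longrightarrow> m x (y - z) = m x y - m x z"
  using m_add(1)[of "x - y" y z] m_add(2)[of x "y - z" z] by simp_all

lemma n_diff: "\<lbrakk>a \<in> W; b \<in> W; c \<in> W\<rbrakk> \<Longrightarrow> n (a - b) c = n a c - n b c"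
  "\<lbrakk>a \<in> W; b \<in> W; c \<in> W\<rbrakk> \<Longrightarrow> n a (b - c) = n a b - n a c"
  using n_add(1)[of "a - b" b c] n_add(2)[of a "b - c" c] by simp_all

lemma p_zero [simp]: "a \<in> W \<Longrightarrow> p 0 a = 0" "x \<in> V \<Longrightarrow> p x 0 = 0"
  using p_diff(1)[of 0 0] p_diff(2)[of _ 0 0] by simp_all

lemma m_zero [simp]: "x \<in> V \<Longrightarrow> m 0 x = 0" "x \<in> V \<Longrightarrow> m x 0 = 0"
  using m_diff(1)[of 0 0] m_diff(2)[of _ 0 0] by simp_all

lemma n_zero [simp]: "a \<in> W \<Longrightarrow> n 0 a = 0" "a \<in> W \<Longrightarrow> n a 0 = 0"
  using n_diff(1)[of 0 0] n_diff(2)[of _ 0 0] by simp_all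

lemma p_minus: "\<lbrakk>x \<in> V; a \<in> W\<rbrakk> \<Longrightarrow> p (- x) a = - p x a"
  "\<lbrakk>x \<in> V; a \<in> W\<rbrakk> \<Longrightarrow> p x (- a) = - p x a"
  using p_diff(1)[of 0 x a] p_diff(2)[of x 0 a] by simp_all

lemma m_minus: "\<lbrakk>x \<in> V; y \<in> V\<rbrakk> \<Longrightarrow> m (- x) y = - m x y"
  "\<lbrakk>x \<in> V; y \<in> V\<rbrakk> \<Longrightarrow> m x (- y) = - m x y"
  using m_diff(1)[of 0 x y] m_diff(2)[of x 0 y] by simp_all

lemma n_minus: "\<lbrakk>a \<in> W; b \<in> W\<rbrakk> \<Longrightarrow> n (- a) b = - n a b"
  "\<lbrakk>a \<in> W; b \<in> W\<rbrakk> \<Longrightarrow> n a (- b) = - n a b"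
  using n_diff(1)[of 0 a b] n_diff(2)[of a 0 b] by simp_all

section \<open>The dual actions as representations\<close>

lemmas biadditive = p_add p_diff p_minus m_add m_diff m_minus n_add n_diff n_minus
lemmas adjoint = p_l p_r p_l' p_r'

text \<open>Additivity passes from the products to the actions through the adjoint formulas, because
  pairings with \<open>V\<close> separate the elements of \<open>W\<close>.\<close>

lemma l_add: "\<lbrakk>x \<in> V; y \<in> V; a \<in> W\<rbrakk> \<Longrightarrow> l (x + y) a = l x a + l y a"
  "\<lbrakk>x \<in> V; a \<in> W; b \<in> W\<rbrakk> \<Longrightarrow> l x (a + b) = l x a + l x b"
  by (rule separates(2); simp add: biadditive adjoint)+

lemma r_add: "\<lbrakk>x \<in> V; y \<in> V; a \<in> W\<rbrakk> \<Longrightarrow> r (x + y) a = r x a + r y a"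
  "\<lbrakk>x \<in> V; a \<in> W; b \<in> W\<rbrakk> \<Longrightarrow> r x (a + b) = r x a + r x b"
  by (rule separates(2); simp add: biadditive adjoint)+

text \<open>Paired with \<open>z\<close>, this is the transposed Jacobi identity of the commutator,
  which is the cyclic sum of three pre-Lie identities.\<close>

lemma l_bracket:
  assumes "x \<in> V" "y \<in> V" "a \<in> W"
  shows "l (m x y - m y x) a = l x (l y a) - l y (l x a)"
proof (rule separates(2))
  fix z assume z: "z \<in> V"
  \<comment> \<open>The pre-Lie identity is solved for one product, so that its three cyclic
    instances below can serve as rewrite rules without looping.\<close>
  have *: "p (m (m u v) w) a = p (m u (m v w)) a + p (m (m v u) w) a - p (m v (m u w)) a"
    if "u \<in> V" "v \<in> V" "w \<in> V" for u v w
  proof -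
    have "m (m u v) w = m u (m v w) + m (m v u) w - m v (m u w)"
      using pre_lie_V[OF that] by (simp add: algebra_simps)
    with that assms(3) show ?thesis by (simp add: biadditive)
  qed
  show "p z (l (m x y - m y x) a) = p z (l x (l y a) - l y (l x a))"
    using assms z
    by (simp add: biadditive adjoint *[OF assms(1,2) z] *[OF assms(2) z assms(1)] *[OF z assms(1,2)] algebra_simps)
qed (use assms in simp_all)

text \<open>The operator \<open>r x - l x\<close> is the transpose of left multiplication by
  \<open>x\<close>. Left multiplications represent the commutator, by the pre-Lie identity, and
  transposition reverses the order of composition.\<close>

lemma lr_bracket:
  assumes "x \<in> V" "y \<in> V" "a \<in> W"
  shows "r (m x y - m y x) a - l (m x y - m y x) a =
    r y (r x a - l x a) - l y (r x a - l x a) - (r x (r y a - l y a) - l x (r y a - l y a))"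
proof (rule separates(2))
  fix z assume z: "z \<in> V"
  have "m (m x y) z = m x (m y z) + m (m y x) z - m y (m x z)"
    using pre_lie_V[OF assms(1,2) z] by (simp add: algebra_simps)
  with assms z show "p z (r (m x y - m y x) a - l (m x y - m y x) a) =
    p z (r y (r x a - l x a) - l y (r x a - l x a) - (r x (r y a - l y a) - l x (r y a - l y a)))"
    by (simp add: biadditive adjoint)
qed (use assms in simp_all)

text \<open>The untwisted compatibility of \<mu> with \<rho> in a representation, for
  \<open>r\<close> as \<mu> and \<open>l\<close> as \<rho>. Paired with \<open>z\<close> it is the
  pre-Lie identity of \<open>x\<close>, \<open>z\<close>, \<open>y\<close>.\<close>

lemma r_mult:
  assumes "x \<in> V" "y \<in> V" "a \<in> W"
  shows "r y (r x a) - r (m x y) a = r y (l x a) - l x (r y a)"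
proof (rule separates(2))
  fix z assume z: "z \<in> V"
  have "p (m (m x z) y - m x (m z y)) a = p (m (m z x) y - m z (m x y)) a"
    using pre_lie_V[of x z y] assms z by simp
  then show "p z (r y (r x a) - r (m x y) a) = p z (r y (l x a) - l x (r y a))"
    using assms z by (simp add: biadditive adjoint algebra_simps)
qed (use assms in simp_all)

text \<open>
  The cocycle condition for the transpose \<open>V \<rightarrow> V \<otimes> V\<close> of \<open>n\<close>, evaluated at \<open>a \<otimes> b\<close>: the transpose of
  left multiplication by \<open>x\<close> is \<open>r x - l x\<close>, that of the commutator with \<open>x\<close> is \<open>- l x\<close>.
\<close>

definition cocycle_defect :: "'v \<Rightarrow> 'v \<Rightarrow> 'w \<Rightarrow> 'w \<Rightarrow> 'k" where
  "cocycle_defect x y a b =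
     p (m x y - m y x) (n a b) -
       (p y (n (r x a - l x a) b) - p y (n a (l x b)) -
       (p x (n (r y a - l y a) b) - p x (n a (l y b))))"

section \<open>Matched pair equations as a cocycle condition\<close>

lemma left_mult_adjoint:
  "\<lbrakk>x \<in> V; y \<in> V; a \<in> W\<rbrakk> \<Longrightarrow> p (m x y) a = p y (r x a - l x a)"
  by (simp add: biadditive adjoint)

text \<open>Together with \<open>r_swap\<close>, this exchanges the acting element with the tested
  one. It serves when the acting element is itself the result of an action and has to be brought out
  of the operator.\<close>

lemma l_swap: "\<lbrakk>x \<in> V; y \<in> V; a \<in> W\<rbrakk> \<Longrightarrow> p y (l x a) = - p x (l y a)"
  by (simp add: p_l)

lemma r_swap: "\<lbrakk>x \<in> V; y \<in> V; a \<in> W\<rbrakk> \<Longrightarrow> p y (r x a) = p x (r y a - l y a)"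
  by (simp add: biadditive adjoint)

lemma eq_iff_pairing_W:
  assumes "a \<in> W" "b \<in> W"
  shows "a = b \<longleftrightarrow> (\<forall>x\<in>V. p x a = p x b)"
  using assms separates(2) by blast

lemma eq_iff_pairing_V:
  assumes "x \<in> V" "y \<in> V"
  shows "x = y \<longleftrightarrow> (\<forall>a\<in>W. p x a = p y a)"
  using assms separates(1) by blast

text \<open>Paired with \<open>y\<close>, the two sides differ exactly by the defect. In two terms
  \<open>x\<close> is hidden in the acting element, as in \<open>r (r' b x) a\<close>; the swap
  identities make \<open>y\<close> the acting element, after which the adjoint formulas release
  \<open>x\<close>.\<close>

lemma matched_l_iff:
  assumes "x \<in> V" "a \<in> W" "b \<in> W"
  shows "l x (n a b) = - l (l' a x - r' a x) b + n (l x a - r x a) b + r (r' b x) a + n a (l x b)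
     \<longleftrightarrow> (\<forall>y\<in>V. cocycle_defect x y a b = 0)" (is "?L = ?R \<longleftrightarrow> _")
proof -
  have "p y ?L = p y ?R \<longleftrightarrow> cocycle_defect x y a b = 0" if y: "y \<in> V" for y
  proof -
    have "p y (l (l' a x - r' a x) b) = p x (n a (l y b))"
      using assms y l_swap[of "l' a x - r' a x" y b] by (simp add: biadditive p_l' p_r')
    moreover have "p y (r (r' b x) a) = p x (n (r y a - l y a) b)"
      using assms y r_swap[of "r' b x" y a] by (simp add: p_r')
    ultimately have "p y ?R - p y ?L = cocycle_defect x y a b"
      using assms y by (simp add: cocycle_defect_def biadditive p_l)
    then show ?thesis by (metis eq_iff_diff_eq_0)
  qed
  then show ?thesis using assms by (subst eq_iff_pairing_W) simp_all
qed

text \<open>The test element \<open>b\<close> takes the first tensor slot and \<open>a\<close> the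
  second, because \<open>r' a\<close> is adjoint to right multiplication by \<open>a\<close>. Up to
  this renaming the scalar is the one found for \<open>matched_l\<close>.\<close>

lemma matched_r_iff:
  assumes "x \<in> V" "y \<in> V" "a \<in> W"
  shows "r' a (m x y - m y x) = r' (l y a) x - r' (l x a) y + m x (r' a y) - m y (r' a x)
     \<longleftrightarrow> (\<forall>b\<in>W. cocycle_defect x y b a = 0)" (is "?L = ?R \<longleftrightarrow> _")
proof -
  have *: "p (m u (r' a v)) b = p v (n (r u b) a) - p v (n (l u b) a)"
    if "u \<in> V" "v \<in> V" "b \<in> W" for u v b
    using assms that left_mult_adjoint[of u "r' a v" b] by (simp add: biadditive p_r')
  have "p ?L b - p ?R b = cocycle_defect x y b a" if b: "b \<in> W" for b
    using assms b by (simp add: cocycle_defect_def biadditive p_r' *)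
  then have "p ?L b = p ?R b \<longleftrightarrow> cocycle_defect x y b a = 0" if b: "b \<in> W" for b
    using b by (metis eq_iff_diff_eq_0)
  then show ?thesis using assms by (subst eq_iff_pairing_V) simp_all
qed

definition "cocycle \<longleftrightarrow> (\<forall>x\<in>V. \<forall>y\<in>V. \<forall>a\<in>W. \<forall>b\<in>W. cocycle_defect x y a b = 0)"

definition matched_l where
  "matched_l \<longleftrightarrow> (\<forall>x\<in>V. \<forall>a\<in>W. \<forall>b\<in>W. l x (n a b) =
     - l (l' a x - r' a x) b + n (l x a - r x a) b + r (r' b x) a + n a (l x b))"

definition matched_r where
  "matched_r \<longleftrightarrow> (\<forall>x\<in>V. \<forall>y\<in>V. \<forall>a\<in>W. r' a (m x y - m y x) =
     r' (l y a) x - r' (l x a) y + m x (r' a y) - m y (r' a x))"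

text \<open>For the swapped pair, \<open>matched_l\<close> and \<open>matched_r\<close> are the
  equations for \<open>l\<^sub>B\<close> and \<open>r\<^sub>A\<close>. The four matched pair
  equations thus amount to two cocycle conditions.\<close>

lemma matched_l_cocycle: "matched_l \<longleftrightarrow> cocycle"
  unfolding matched_l_def cocycle_def using matched_l_iff by blast

lemma matched_r_cocycle: "matched_r \<longleftrightarrow> cocycle"
  unfolding matched_r_def cocycle_def using matched_r_iff by blast

section \<open>The untwisted double and its pre-Lie identity\<close>

definition double :: "'v \<times> 'w \<Rightarrow> 'v \<times> 'w \<Rightarrow> 'v \<times> 'w" where
  "double = (\<lambda>(x, a) (y, b). (m x y + l' a y + r' b x, n a b + l x b + r y a))"

lemma double_simps:
  "double (x, a) (y, b) = (m x y + l' a y + r' b x, n a b + l x b + r y a)"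
  by (simp add: double_def)

lemma l_diff: "\<lbrakk>x \<in> V; y \<in> V; a \<in> W\<rbrakk> \<Longrightarrow> l (x - y) a = l x a - l y a"
  "\<lbrakk>x \<in> V; a \<in> W; b \<in> W\<rbrakk> \<Longrightarrow> l x (a - b) = l x a - l x b"
  using l_add(1)[of "x - y" y] l_add(2)[of x "a - b" b] by simp_all

lemma r_diff: "\<lbrakk>x \<in> V; y \<in> V; a \<in> W\<rbrakk> \<Longrightarrow> r (x - y) a = r x a - r y a"
  "\<lbrakk>x \<in> V; a \<in> W; b \<in> W\<rbrakk> \<Longrightarrow> r x (a - b) = r x a - r x b"
  using r_add(1)[of "x - y" y] r_add(2)[of x "a - b" b] by simp_all

lemma l_zero [simp]: "a \<in> W \<Longrightarrow> l 0 a = 0" "x \<in> V \<Longrightarrow> l x 0 = 0"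
  using l_diff(1)[of 0 0] l_diff(2)[of _ 0 0] by simp_all

lemma r_zero [simp]: "a \<in> W \<Longrightarrow> r 0 a = 0" "x \<in> V \<Longrightarrow> r x 0 = 0"
  using r_diff(1)[of 0 0] r_diff(2)[of _ 0 0] by simp_all

lemma l_minus: "\<lbrakk>x \<in> V; a \<in> W\<rbrakk> \<Longrightarrow> l (- x) a = - l x a" "\<lbrakk>x \<in> V; a \<in> W\<rbrakk> \<Longrightarrow> l x (- a) = - l x a"
  using l_diff(1)[of 0 x a] l_diff(2)[of x 0 a] by simp_all

lemma r_minus: "\<lbrakk>x \<in> V; a \<in> W\<rbrakk> \<Longrightarrow> r (- x) a = - r x a" "\<lbrakk>x \<in> V; a \<in> W\<rbrakk> \<Longrightarrow> r x (- a) = - r x a"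
  using r_diff(1)[of 0 x a] r_diff(2)[of x 0 a] by simp_all

lemmas action_additive = l_add l_diff l_minus r_add r_diff r_minus

end

text \<open>The identity is additive in each argument and splits according to which summand each
  argument lies in. Every part with values in \<open>V\<close> is the pre-Lie identity of
  \<open>m\<close>, a representation identity, or one of the two matched pair equations with values
  in \<open>V\<close>.\<close>

lemma (in dual_pre_lie) double_fst:
  assumes mr: "matched_r" and ml: "dual_pre_lie.matched_l W V m l' r' l r"
    and xyz: "x \<in> V" "y \<in> V" "z \<in> V" "a \<in> W" "b \<in> W" "c \<in> W"
  shows "fst (double (double (x, a) (y, b)) (z, c) - double (x, a) (double (y, b) (z, c))) =
    fst (double (double (y, b) (x, a)) (z, c) - double (y, b) (double (x, a) (z, c)))"
    (is "?L = ?R")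
proof -
  interpret s: dual_pre_lie W V "\<lambda>a x. p x a" n m l' r' l r by (rule swap)
  \<comment> \<open>All ingredients are stated as expressions equal to zero, so that
    \<open>?L - ?R\<close> can be displayed as their signed sum.\<close>
  have ml': "l' a (m x y) - (m x (l' a y) + r' (r y a) x + m (l' a x - r' a x) y - l' (l x a - r x a) y) = 0"
    if "x \<in> V" "y \<in> V" "a \<in> W" for x y a
    using ml that unfolding s.matched_l_def by (simp add: algebra_simps)
  have mr': "r' a (m x y - m y x) - (r' (l y a) x - r' (l x a) y + m x (r' a y) - m y (r' a x)) = 0"
    if "x \<in> V" "y \<in> V" "a \<in> W" for x y a
    using mr that unfolding matched_r_def by simp
  have pl: "(m (m x y) z - m x (m y z)) - (m (m y x) z - m y (m x z)) = 0"
    using pre_lie_V xyz by simp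
  have lb: "l' (n a b - n b a) z - (l' a (l' b z) - l' b (l' a z)) = 0"
    using s.l_bracket xyz by simp
  have rm: "(r' c (r' b x) - r' (n b c) x) - (r' c (l' b x) - l' b (r' c x)) = 0"
    if "x \<in> V" "b \<in> W" for x b
    using s.r_mult that xyz by simp
  \<comment> \<open>The eight components of the identity on \<open>V \<oplus> W\<close>; the eighth, of type \<open>W\<close>, \<open>W\<close>, \<open>W\<close>, has no \<open>V\<close>-part.\<close>
  have "?L - ?R = ((m (m x y) z - m x (m y z)) - (m (m y x) z - m y (m x z)))
     + (r' c (m x y - m y x) - (r' (l y c) x - r' (l x c) y + m x (r' c y) - m y (r' c x)))
     + (l' b (m x z) - (m x (l' b z) + r' (r z b) x + m (l' b x - r' b x) z - l' (l x b - r x b) z))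
     - (l' a (m y z) - (m y (l' a z) + r' (r z a) y + m (l' a y - r' a y) z - l' (l y a - r y a) z))
     + (l' (n a b - n b a) z - (l' a (l' b z) - l' b (l' a z)))
     + ((r' c (r' b x) - r' (n b c) x) - (r' c (l' b x) - l' b (r' c x)))
     - ((r' c (r' a y) - r' (n a c) y) - (r' c (l' a y) - l' a (r' c y)))"
    using xyz by (simp add: double_simps biadditive action_additive s.action_additive algebra_simps)
  also have "\<dots> = 0"
    by (simp only: pl mr' ml' lb rm xyz) simp
  finally show ?thesis by simp
qed

text \<open>Turns the second component of an identity in the double into the first component of the
  same identity for the swapped pair.\<close>

lemma (in dual_pre_lie) swap_double:
  "dual_pre_lie.double n m l' r' l r (prod.swap u) (prod.swap v) = prod.swap (double u v)"
proof -
  interpret s: dual_pre_lie W V "\<lambda>a x. p x a" n m l' r' l r by (rule swap)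
  show ?thesis by (cases u; cases v) (simp add: double_simps s.double_simps algebra_simps)
qed

text \<open>The pre-Lie identity is evaluated on pure elements: arguments of type \<open>V\<close>,
  \<open>V\<close>, \<open>W\<close> give \<open>matched_r\<close> in the first component, and those
  of type \<open>V\<close>, \<open>W\<close>, \<open>V\<close> give the swapped
  \<open>matched_l\<close>.\<close>

lemma (in dual_pre_lie) double_matched:
  assumes d: "\<And>u v w. \<lbrakk>u \<in> V \<times> W; v \<in> V \<times> W; w \<in> V \<times> W\<rbrakk> \<Longrightarrow>
    double (double u v) w - double u (double v w) = double (double v u) w - double v (double u w)"
  shows "matched_r" "dual_pre_lie.matched_l W V m l' r' l r"
proof -
  interpret s: dual_pre_lie W V "\<lambda>a x. p x a" n m l' r' l r by (rule swap)
  show matched_r unfolding matched_r_def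
  proof (intro ballI)
    fix x y a assume "x \<in> V" "y \<in> V" "a \<in> W"
    then show "r' a (m x y - m y x) = r' (l y a) x - r' (l x a) y + m x (r' a y) - m y (r' a x)"
      using d[of "(x, 0)" "(y, 0)" "(0, a)"] by (simp add: double_simps s.action_additive algebra_simps)
  qed
  show s.matched_l unfolding s.matched_l_def
  proof (intro ballI)
    fix a x y assume "x \<in> V" "y \<in> V" "a \<in> W"
    then show "l' a (m x y) =
     - l' (l x a - r x a) y + m (l' a x - r' a x) y + r' (r y a) x + m x (l' a y)"
      using d[of "(x, 0)" "(0, a)" "(y, 0)"] by (simp add: double_simps m_diff s.action_additive algebra_simps)
  qed
qed

text \<open>Given the cocycle conditions, \<open>double_fst\<close> is applied to the pair and to
  the swapped pair, one for each component. Conversely the first component alone yields both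
  conditions, since \<open>matched_r\<close> is equivalent to \<open>cocycle\<close> and the swapped
  \<open>matched_l\<close> to the swapped \<open>cocycle\<close>.\<close>

lemma (in dual_pre_lie) double_pre_lie_iff:
  "(\<forall>u\<in>V \<times> W. \<forall>v\<in>V \<times> W. \<forall>w\<in>V \<times> W.
    double (double u v) w - double u (double v w) = double (double v u) w - double v (double u w))
   \<longleftrightarrow> cocycle \<and> dual_pre_lie.cocycle W V (\<lambda>a x. p x a) n m l' r'" (is "?D \<longleftrightarrow> _")
proof -
  interpret s: dual_pre_lie W V "\<lambda>a x. p x a" n m l' r' l r by (rule swap)
  have "?D" if c: "cocycle" "s.cocycle"
  proof (intro ballI)
    fix u v w assume uvw: "u \<in> V \<times> W" "v \<in> V \<times> W" "w \<in> V \<times> W"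
    have "fst (double (double u v) w - double u (double v w)) =
      fst (double (double v u) w - double v (double u w))"
      using uvw c double_fst[of "fst u" "fst v" "fst w" "snd u" "snd v" "snd w"]
      by (auto simp: matched_r_cocycle s.matched_l_cocycle)
    moreover have "fst (s.double (s.double (prod.swap u) (prod.swap v)) (prod.swap w)
        - s.double (prod.swap u) (s.double (prod.swap v) (prod.swap w))) =
      fst (s.double (s.double (prod.swap v) (prod.swap u)) (prod.swap w)
        - s.double (prod.swap v) (s.double (prod.swap u) (prod.swap w)))"
      using uvw c s.double_fst[of "snd u" "snd v" "snd w" "fst u" "fst v" "fst w"]
      by (auto simp: s.matched_r_cocycle matched_l_cocycle)
    ultimately show "double (double u v) w - double u (double v w) = double (double v u) w - double v (double u w)"
      by (simp add: swap_double prod_eq_iff)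
  qed
  moreover have "cocycle \<and> s.cocycle" if ?D
    using double_matched that by (simp add: matched_r_cocycle s.matched_l_cocycle)
  ultimately show ?thesis by blast
qed

text \<open>Moving every action across the pairing turns both sides into the same combination of
  values of \<open>p\<close> on products in \<open>V\<close> and in \<open>W\<close>.\<close>

lemma (in dual_pre_lie) double_form_invariant:
  assumes "u \<in> V \<times> W" "v \<in> V \<times> W" "w \<in> V \<times> W"
  shows "p (fst w) (snd (double u v)) - p (fst (double u v)) (snd w) =
    - (p (fst (double u w - double w u)) (snd v) - p (fst v) (snd (double u w - double w u)))"
  using assms by (auto simp: double_simps biadditive adjoint)

section \<open>Hom-pre-Lie algebras in duality\<close>

lemma linear_on_diff:
  fixes f :: "'v::ab_group_add \<Rightarrow> 'w::ab_group_add"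
  assumes "linear_on s t V W f" "x \<in> V" "y \<in> V" "x - y \<in> V"
  shows "f (x - y) = f x - f y"
  using linear_onD(2)[OF assms(1), of "x - y" y] assms by simp

lemma bilinear_on_add:
  assumes "bilinear_on s t r U V W f"
  shows "\<lbrakk>x \<in> U; y \<in> U; v \<in> V\<rbrakk> \<Longrightarrow> f (x + y) v = f x v + f y v"
    "\<lbrakk>x \<in> U; v \<in> V; w \<in> V\<rbrakk> \<Longrightarrow> f x (v + w) = f x v + f x w"
  using bilinear_onD[OF assms] by (auto simp: linear_on_def)

lemma bilinear_on_scale:
  assumes "bilinear_on s t r U V W f"
  shows "\<lbrakk>x \<in> U; y \<in> V\<rbrakk> \<Longrightarrow> f (s c x) y = r c (f x y)"
    "\<lbrakk>x \<in> U; y \<in> V\<rbrakk> \<Longrightarrow> f x (t c y) = r c (f x y)"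
  using bilinear_onD[OF assms] by (auto simp: linear_on_def)

lemma bilinear_on_closed:
  assumes "bilinear_on s t r U V W f"
  shows "\<lbrakk>x \<in> U; y \<in> V\<rbrakk> \<Longrightarrow> f x y \<in> W"
  using bilinear_onD[OF assms] by (auto simp: linear_on_def)

lemma (in fd_vspace) closed_V:
  shows "0 \<in> V" "\<lbrakk>x \<in> V; y \<in> V\<rbrakk> \<Longrightarrow> x + y \<in> V" "\<lbrakk>x \<in> V; y \<in> V\<rbrakk> \<Longrightarrow> x - y \<in> V"
    "x \<in> V \<Longrightarrow> - x \<in> V" "x \<in> V \<Longrightarrow> scale c x \<in> V"
  using subspace_V by (auto simp: subspace_0 subspace_add subspace_diff subspace_neg subspace_scale)

context hom_pre_lie_algebra
begin

lemma mult_closed: "\<lbrakk>x \<in> A; y \<in> A\<rbrakk> \<Longrightarrow> x \<cdot> y \<in> A"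
  by (rule bilinear_on_closed[OF mult_bilinear])

lemmas mult_add = bilinear_on_add[OF mult_bilinear]
lemmas mult_scale = bilinear_on_scale[OF mult_bilinear]
lemmas alpha_closed = linear_onD(1)[OF alpha_linear]
lemmas alpha_add = linear_onD(2)[OF alpha_linear]
lemmas alpha_scale = linear_onD(3)[OF alpha_linear]

lemma mult_diff:
  assumes "x \<in> A" "y \<in> A" "z \<in> A"
  shows "(x - y) \<cdot> z = x \<cdot> z - y \<cdot> z" "z \<cdot> (x - y) = z \<cdot> x - z \<cdot> y"
  using mult_add(1)[of "x - y" y z] mult_add(2)[of z "x - y" y] assms closed_V by simp_all

lemma alpha_diff: "\<lbrakk>x \<in> A; y \<in> A\<rbrakk> \<Longrightarrow> \<alpha> (x - y) = \<alpha> x - \<alpha> y"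
  by (intro linear_on_diff[OF alpha_linear] closed_V)

lemma alpha_minus: "x \<in> A \<Longrightarrow> \<alpha> (- x) = - \<alpha> x"
  using alpha_diff[of 0 x] alpha_diff[of 0 0] closed_V(1) by simp

lemma commutator_closed: "\<lbrakk>x \<in> A; y \<in> A\<rbrakk> \<Longrightarrow> commutator mult x y \<in> A"
  by (simp add: commutator_def closed_V mult_closed)

text \<open>The Hom-Jacobi sum is minus the sum of the three cyclic instances of the Hom-pre-Lie
  identity.\<close>

lemma sub_adjacent: "hom_lie_algebra scale A (commutator mult) \<alpha>"
proof unfold_locales
  show "bilinear_on scale scale scale A A A (commutator mult)"
    by (simp add: bilinear_on_def linear_on_def commutator_def closed_V mult_closed mult_add mult_scale
        scale_right_diff_distrib)
  show "linear_on scale scale A A \<alpha>" by (rule alpha_linear)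
  fix x y z assume x: "x \<in> A" and y: "y \<in> A"
  show "commutator mult x y = - commutator mult y x" by (simp add: commutator_def)
  show "\<alpha> (commutator mult x y) = commutator mult (\<alpha> x) (\<alpha> y)"
    using x y by (simp add: commutator_def alpha_diff mult_closed alpha_mult)
  assume z: "z \<in> A"
  have *: "(u \<cdot> v) \<cdot> \<alpha> w - \<alpha> u \<cdot> (v \<cdot> w) - ((v \<cdot> u) \<cdot> \<alpha> w - \<alpha> v \<cdot> (u \<cdot> w)) = 0"
    if "u \<in> A" "v \<in> A" "w \<in> A" for u v w
    using hom_pre_lie[OF that] by simp
  have "commutator mult (\<alpha> x) (commutator mult y z) + commutator mult (\<alpha> y) (commutator mult z x)
      + commutator mult (\<alpha> z) (commutator mult x y) =
    - (((x \<cdot> y) \<cdot> \<alpha> z - \<alpha> x \<cdot> (y \<cdot> z) - ((y \<cdot> x) \<cdot> \<alpha> z - \<alpha> y \<cdot> (x \<cdot> z)))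
    + ((y \<cdot> z) \<cdot> \<alpha> x - \<alpha> y \<cdot> (z \<cdot> x) - ((z \<cdot> y) \<cdot> \<alpha> x - \<alpha> z \<cdot> (y \<cdot> x)))
    + ((z \<cdot> x) \<cdot> \<alpha> y - \<alpha> z \<cdot> (x \<cdot> y) - ((x \<cdot> z) \<cdot> \<alpha> y - \<alpha> x \<cdot> (z \<cdot> y))))"
    using x y z by (simp add: commutator_def mult_diff mult_closed alpha_closed)
  also have "\<dots> = 0" by (simp only: * x y z) simp
  finally show "commutator mult (\<alpha> x) (commutator mult y z) + commutator mult (\<alpha> y) (commutator mult z x)
      + commutator mult (\<alpha> z) (commutator mult x y) = 0" .
qed

end

text \<open>\<open>W\<close> is only identified with the dual of \<open>V\<close> through
  \<open>p\<close>, and \<open>V\<close> with that of \<open>W\<close>, so that the assumptions are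
  symmetric and no bidual appears on swapping. Since \<open>pairing_twist\<close> makes \<beta> the
  contragredient of \<alpha>, the inverse square of \<alpha> in the star operators shows up as
  \<beta> applied twice.\<close>

locale hom_dual_pair =
  V: regular_hom_pre_lie_algebra sV V m \<alpha> + W: regular_hom_pre_lie_algebra sW W n \<beta>
  for sV :: "'k::field \<Rightarrow> 'v::ab_group_add \<Rightarrow> 'v" and V m \<alpha>
    and sW :: "'k \<Rightarrow> 'w::ab_group_add \<Rightarrow> 'w" and W n \<beta> +
  fixes p :: "'v \<Rightarrow> 'w \<Rightarrow> 'k"
    and l r :: "'v \<Rightarrow> 'w \<Rightarrow> 'w" and l' r' :: "'w \<Rightarrow> 'v \<Rightarrow> 'v"
  assumes pairing_bilinear: "bilinear_on sV sW (*) V W UNIV p"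
    and dual_bij: "bij_betw (\<lambda>a x. if x \<in> V then p x a else 0) W (dual sV V)"
    and dual_bij': "bij_betw (\<lambda>x a. if a \<in> W then p x a else 0) V (dual sW W)"
    and pairing_twist: "\<lbrakk>x \<in> V; a \<in> W\<rbrakk> \<Longrightarrow> p (\<alpha> x) (\<beta> a) = p x a"
    and action_closed: "\<lbrakk>x \<in> V; a \<in> W\<rbrakk> \<Longrightarrow> l x a \<in> W" "\<lbrakk>x \<in> V; a \<in> W\<rbrakk> \<Longrightarrow> r x a \<in> W"
      "\<lbrakk>x \<in> V; a \<in> W\<rbrakk> \<Longrightarrow> l' a x \<in> V" "\<lbrakk>x \<in> V; a \<in> W\<rbrakk> \<Longrightarrow> r' a x \<in> V"
    and pairing_l: "\<lbrakk>x \<in> V; y \<in> V; a \<in> W\<rbrakk> \<Longrightarrow> p y (l x a) = - p (commutator m (\<alpha> x) y) (\<beta> (\<beta> a))"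
    and pairing_r: "\<lbrakk>x \<in> V; y \<in> V; a \<in> W\<rbrakk> \<Longrightarrow> p y (r x a) = p (m y (\<alpha> x)) (\<beta> (\<beta> a))"
    and pairing_l': "\<lbrakk>x \<in> V; a \<in> W; b \<in> W\<rbrakk> \<Longrightarrow> p (l' a x) b = - p (\<alpha> (\<alpha> x)) (commutator n (\<beta> a) b)"
    and pairing_r': "\<lbrakk>x \<in> V; a \<in> W; b \<in> W\<rbrakk> \<Longrightarrow> p (r' a x) b = p (\<alpha> (\<alpha> x)) (n b (\<beta> a))"
begin

lemma swap: "hom_dual_pair sW W n \<beta> sV V m \<alpha> (\<lambda>a x. p x a) l' r' l r"
  using pairing_bilinear dual_bij dual_bij' pairing_twist action_closed
    pairing_l pairing_r pairing_l' pairing_r'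
  by unfold_locales (auto simp: bilinear_on_def)

lemmas pairing_add = bilinear_on_add[OF pairing_bilinear]
lemmas pairing_scale = bilinear_on_scale[OF pairing_bilinear]

section \<open>Inverse twists and untwisted operations\<close>

definition "ai = inv_into V \<alpha>"
definition "bi = inv_into W \<beta>"

lemma ai [simp]: "x \<in> V \<Longrightarrow> ai x \<in> V" "x \<in> V \<Longrightarrow> \<alpha> (ai x) = x" "x \<in> V \<Longrightarrow> ai (\<alpha> x) = x"
  using V.regular by (auto simp: ai_def bij_betw_def inv_into_into f_inv_into_f)

lemma bi [simp]: "x \<in> W \<Longrightarrow> bi x \<in> W" "x \<in> W \<Longrightarrow> \<beta> (bi x) = x" "x \<in> W \<Longrightarrow> bi (\<beta> x) = x"
  using W.regular by (auto simp: bi_def bij_betw_def inv_into_into f_inv_into_f)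

lemmas carrier [simp] = V.closed_V W.closed_V V.alpha_closed W.alpha_closed V.mult_closed W.mult_closed
  V.commutator_closed W.commutator_closed action_closed

lemma ai_add: "\<lbrakk>x \<in> V; y \<in> V\<rbrakk> \<Longrightarrow> ai (x + y) = ai x + ai y"
  by (metis V.alpha_add V.closed_V(2) ai)

lemma bi_add: "\<lbrakk>x \<in> W; y \<in> W\<rbrakk> \<Longrightarrow> bi (x + y) = bi x + bi y"
  by (metis W.alpha_add W.closed_V(2) bi)

lemma ai_diff: "\<lbrakk>x \<in> V; y \<in> V\<rbrakk> \<Longrightarrow> ai (x - y) = ai x - ai y"
  by (metis V.alpha_diff V.closed_V(3) ai)

lemma bi_diff: "\<lbrakk>x \<in> W; y \<in> W\<rbrakk> \<Longrightarrow> bi (x - y) = bi x - bi y"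
  by (metis W.alpha_diff W.closed_V(3) bi)

lemma bi_minus: "x \<in> W \<Longrightarrow> bi (- x) = - bi x"
  by (metis W.alpha_minus W.closed_V(4) bi)

lemma ai_scale: "x \<in> V \<Longrightarrow> ai (sV c x) = sV c (ai x)"
  by (metis V.alpha_scale V.closed_V(5) ai)

lemma pairing_ai: "\<lbrakk>x \<in> V; a \<in> W\<rbrakk> \<Longrightarrow> p (ai x) a = p x (\<beta> a)"
  using pairing_twist[of "ai x" a] by simp

lemma pairing_bi: "\<lbrakk>x \<in> V; a \<in> W\<rbrakk> \<Longrightarrow> p x (bi a) = p (\<alpha> x) a"
  using pairing_twist[of x "bi a"] by simp

definition mu where "mu x y = ai (m x y)"
definition nu where "nu a b = bi (n a b)"
definition lu where "lu x a = bi (l x a)"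
definition ru where "ru x a = bi (r x a)"
definition lu' where "lu' a x = ai (l' a x)"
definition ru' where "ru' a x = ai (r' a x)"

lemma pairing_zero [simp]: "a \<in> W \<Longrightarrow> p 0 a = 0" "x \<in> V \<Longrightarrow> p x 0 = 0"
  by (metis add_0 add_cancel_left_left pairing_add(1) V.closed_V(1))
    (metis add_0 add_cancel_left_left pairing_add(2) W.closed_V(1))

lemma pairing_diff: "\<lbrakk>x \<in> V; y \<in> V; a \<in> W\<rbrakk> \<Longrightarrow> p (x - y) a = p x a - p y a"
  "\<lbrakk>x \<in> V; a \<in> W; b \<in> W\<rbrakk> \<Longrightarrow> p x (a - b) = p x a - p x b"
  using pairing_add(1)[of "x - y" y a] pairing_add(2)[of x "a - b" b] by simp_all

lemma ai_mult: "\<lbrakk>x \<in> V; y \<in> V\<rbrakk> \<Longrightarrow> ai (m x y) = m (ai x) (ai y)"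
  by (metis V.alpha_mult V.mult_closed ai)

lemma bi_mult: "\<lbrakk>x \<in> W; y \<in> W\<rbrakk> \<Longrightarrow> bi (n x y) = n (bi x) (bi y)"
  by (metis W.alpha_mult W.mult_closed bi)

lemma separate: "\<lbrakk>a \<in> W; b \<in> W; \<And>x. x \<in> V \<Longrightarrow> p x a = p x b\<rbrakk> \<Longrightarrow> a = b"
  by (rule inj_onD[OF bij_betw_imp_inj_on[OF dual_bij]]) auto

text \<open>Applying the inverse twist twice to the Hom-pre-Lie identity gives the pre-Lie identity
  of \<open>mu\<close> and \<open>nu\<close>. In the adjoint formulas the twists cancel by
  invariance of \<open>p\<close>, which leaves the plain coadjoint operators.\<close>

sublocale u: dual_pre_lie V W p mu nu lu ru lu' ru'
proof -
  interpret s: hom_dual_pair sW W n \<beta> sV V m \<alpha> "\<lambda>a x. p x a" l' r' l r by (rule swap)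
  show "dual_pre_lie V W p mu nu lu ru lu' ru'"
  proof unfold_locales
    show "mu (mu x y) z - mu x (mu y z) = mu (mu y x) z - mu y (mu x z)"
      if "x \<in> V" "y \<in> V" "z \<in> V" for x y z
    proof -
      have *: "mu (mu u v) w = ai (ai (m (m u v) (\<alpha> w)))" "mu u (mu v w) = ai (ai (m (\<alpha> u) (m v w)))"
        if "u \<in> V" "v \<in> V" "w \<in> V" for u v w
        using that by (simp_all add: mu_def ai_mult)
      show ?thesis using that V.hom_pre_lie[OF that] by (simp add: * ai_diff[symmetric])
    qed
    show "nu (nu x y) z - nu x (nu y z) = nu (nu y x) z - nu y (nu x z)"
      if "x \<in> W" "y \<in> W" "z \<in> W" for x y z
    proof -
      have *: "nu (nu u v) w = bi (bi (n (n u v) (\<beta> w)))" "nu u (nu v w) = bi (bi (n (\<beta> u) (n v w)))"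
        if "u \<in> W" "v \<in> W" "w \<in> W" for u v w
        using that by (simp_all add: nu_def bi_mult)
      show ?thesis using that W.hom_pre_lie[OF that] by (simp add: * bi_diff[symmetric])
    qed
    show "a = b" if "a \<in> W" "b \<in> W" "\<And>x. x \<in> V \<Longrightarrow> p x a = p x b" for a b
      using separate that .
    show "x = y" if "x \<in> V" "y \<in> V" "\<And>a. a \<in> W \<Longrightarrow> p x a = p y a" for x y
      using s.separate that .
  qed (simp_all add: mu_def nu_def lu_def ru_def lu'_def ru'_def V.mult_add W.mult_add ai_add bi_add
      pairing_add pairing_ai pairing_bi pairing_l pairing_r pairing_l' pairing_r'
      commutator_def pairing_diff V.alpha_mult[symmetric] W.alpha_mult[symmetric] pairing_twist)
qed


lemma untwist:
  "\<lbrakk>x \<in> V; y \<in> V\<rbrakk> \<Longrightarrow> m x y = \<alpha> (mu x y)" "\<lbrakk>a \<in> W; b \<in> W\<rbrakk> \<Longrightarrow> n a b = \<beta> (nu a b)"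
  "\<lbrakk>x \<in> V; a \<in> W\<rbrakk> \<Longrightarrow> l x a = \<beta> (lu x a)" "\<lbrakk>x \<in> V; a \<in> W\<rbrakk> \<Longrightarrow> r x a = \<beta> (ru x a)"
  "\<lbrakk>x \<in> V; a \<in> W\<rbrakk> \<Longrightarrow> l' a x = \<alpha> (lu' a x)" "\<lbrakk>x \<in> V; a \<in> W\<rbrakk> \<Longrightarrow> r' a x = \<alpha> (ru' a x)"
  by (simp_all add: mu_def nu_def lu_def ru_def lu'_def ru'_def)

lemma alpha_mu: "\<lbrakk>x \<in> V; y \<in> V\<rbrakk> \<Longrightarrow> \<alpha> (mu x y) = mu (\<alpha> x) (\<alpha> y)"
  by (simp add: mu_def V.alpha_mult[symmetric])

lemma beta_nu: "\<lbrakk>a \<in> W; b \<in> W\<rbrakk> \<Longrightarrow> \<beta> (nu a b) = nu (\<beta> a) (\<beta> b)"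
  by (simp add: nu_def W.alpha_mult[symmetric])

lemma pairing_alpha: "\<lbrakk>x \<in> V; a \<in> W\<rbrakk> \<Longrightarrow> p (\<alpha> x) a = p x (bi a)"
  by (simp add: pairing_bi)

lemma beta_lu: "\<lbrakk>x \<in> V; a \<in> W\<rbrakk> \<Longrightarrow> \<beta> (lu x a) = lu (\<alpha> x) (\<beta> a)"
  and beta_ru: "\<lbrakk>x \<in> V; a \<in> W\<rbrakk> \<Longrightarrow> \<beta> (ru x a) = ru (\<alpha> x) (\<beta> a)"
proof -
  have *: "p y (\<beta> (lu x a)) = p y (lu (\<alpha> x) (\<beta> a))" "p y (\<beta> (ru x a)) = p y (ru (\<alpha> x) (\<beta> a))"
    if "x \<in> V" "a \<in> W" "y \<in> V" for x y a
  proof -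
    \<comment> \<open>Test elements of the form \<open>\<alpha> z\<close> let
      \<open>pairing_twist\<close> remove the outer \<beta>; as \<alpha> is bijective, they exhaust
      \<open>V\<close>.\<close>
    have "p (\<alpha> z) (\<beta> (lu x a)) = p (\<alpha> z) (lu (\<alpha> x) (\<beta> a))"
      "p (\<alpha> z) (\<beta> (ru x a)) = p (\<alpha> z) (ru (\<alpha> x) (\<beta> a))" if "z \<in> V" for z
      using that \<open>x \<in> V\<close> \<open>a \<in> W\<close> by (simp_all add: pairing_twist u.adjoint alpha_mu[symmetric])
    from this[of "ai y"] show "p y (\<beta> (lu x a)) = p y (lu (\<alpha> x) (\<beta> a))" "p y (\<beta> (ru x a)) = p y (ru (\<alpha> x) (\<beta> a))"
      using that by simp_all
  qed
  show "\<lbrakk>x \<in> V; a \<in> W\<rbrakk> \<Longrightarrow> \<beta> (lu x a) = lu (\<alpha> x) (\<beta> a)"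
    "\<lbrakk>x \<in> V; a \<in> W\<rbrakk> \<Longrightarrow> \<beta> (ru x a) = ru (\<alpha> x) (\<beta> a)"
    by (rule separate; simp add: *)+
qed

lemma alpha_actions: "\<lbrakk>x \<in> V; a \<in> W\<rbrakk> \<Longrightarrow> \<alpha> (lu' a x) = lu' (\<beta> a) (\<alpha> x)"
  "\<lbrakk>x \<in> V; a \<in> W\<rbrakk> \<Longrightarrow> \<alpha> (ru' a x) = ru' (\<beta> a) (\<alpha> x)"
proof -
  interpret s: hom_dual_pair sW W n \<beta> sV V m \<alpha> "\<lambda>a x. p x a" l' r' l r by (rule swap)
  have "s.lu = lu'" "s.ru = ru'"
    by (auto simp: fun_eq_iff s.lu_def s.ru_def lu'_def ru'_def s.bi_def ai_def)
  then show "\<lbrakk>x \<in> V; a \<in> W\<rbrakk> \<Longrightarrow> \<alpha> (lu' a x) = lu' (\<beta> a) (\<alpha> x)"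
    "\<lbrakk>x \<in> V; a \<in> W\<rbrakk> \<Longrightarrow> \<alpha> (ru' a x) = ru' (\<beta> a) (\<alpha> x)"
    using s.beta_lu s.beta_ru by metis+
qed

lemmas equivariant = alpha_mu beta_nu beta_lu beta_ru alpha_actions
  V.alpha_add W.alpha_add V.alpha_diff W.alpha_diff V.alpha_minus W.alpha_minus

lemma action_scale:
  assumes "x \<in> V" "a \<in> W"
  shows "lu (sV c x) a = sW c (lu x a)" "lu x (sW c a) = sW c (lu x a)"
    "ru (sV c x) a = sW c (ru x a)" "ru x (sW c a) = sW c (ru x a)"
proof -
  have *: "mu (sV c y) z = sV c (mu y z)" "mu y (sV c z) = sV c (mu y z)"
    if "y \<in> V" "z \<in> V" for y z
    using that by (simp_all add: mu_def V.mult_scale ai_scale)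
  show "lu (sV c x) a = sW c (lu x a)" "lu x (sW c a) = sW c (lu x a)"
    "ru (sV c x) a = sW c (ru x a)" "ru x (sW c a) = sW c (ru x a)"
    by (rule separate; use assms in \<open>simp add: u.p_l u.p_r * pairing_scale algebra_simps\<close>)+
qed

text \<open>When all twists are pushed inwards, every variable carries exactly two of them on both
  sides. The axioms are therefore untwisted identities at twice twisted arguments, and hold for any
  dual pair.\<close>

lemma representation:
  "hom_pre_lie_representation sV V m \<alpha> sW W \<beta> l r"
proof -
  interpret C: hom_lie_algebra sV V "commutator m" \<alpha> by (rule V.sub_adjacent)
  have lin: "bilinear_on sV sW sW V W W l" "bilinear_on sV sW sW V W W r"
    by (auto simp: bilinear_on_def linear_on_def untwist u.action_additive action_scale
        W.alpha_add W.alpha_scale)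
  show ?thesis
  proof unfold_locales
    fix x y a assume xya: "x \<in> V" "y \<in> V" "a \<in> W"
    show "l (commutator m x y) (\<beta> a) = l (\<alpha> x) (l y a) - l (\<alpha> y) (l x a)"
      using xya u.l_bracket[of "\<alpha> (\<alpha> x)" "\<alpha> (\<alpha> y)" "\<beta> (\<beta> a)"]
      by (simp add: commutator_def untwist equivariant)
    show "r (\<alpha> y) (r x a) - r (m x y) (\<beta> a) = r (\<alpha> y) (l x a) - l (\<alpha> x) (r y a)"
      using xya u.r_mult[of "\<alpha> (\<alpha> x)" "\<alpha> (\<alpha> y)" "\<beta> (\<beta> a)"]
      by (simp add: untwist equivariant)
  qed (simp_all add: W.alpha_linear lin untwist equivariant)
qed

text \<open>The square of a twist permutes its carrier, so a universal statement may be tested at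
  twice twisted arguments. This absorbs the twists acquired when a matched pair equation is
  untwisted.\<close>

lemma all_twist:
  "(\<forall>x\<in>V. P x) \<longleftrightarrow> (\<forall>x\<in>V. P (\<alpha> (\<alpha> x)))" "(\<forall>a\<in>W. Q a) \<longleftrightarrow> (\<forall>a\<in>W. Q (\<beta> (\<beta> a)))"
  using ai(1,2) V.alpha_closed bi(1,2) W.alpha_closed by metis+

lemma all_twist_VWW:
  "(\<forall>x\<in>V. \<forall>a\<in>W. \<forall>b\<in>W. P x a b) \<longleftrightarrow>
     (\<forall>x\<in>V. \<forall>a\<in>W. \<forall>b\<in>W. P (\<alpha> (\<alpha> x)) (\<beta> (\<beta> a)) (\<beta> (\<beta> b)))"
  by (rule trans[OF all_twist(1)], rule ball_cong[OF refl], rule trans[OF all_twist(2)],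
      rule ball_cong[OF refl], rule all_twist(2))

lemma all_twist_VVW:
  "(\<forall>x\<in>V. \<forall>y\<in>V. \<forall>a\<in>W. P x y a) \<longleftrightarrow>
     (\<forall>x\<in>V. \<forall>y\<in>V. \<forall>a\<in>W. P (\<alpha> (\<alpha> x)) (\<alpha> (\<alpha> y)) (\<beta> (\<beta> a)))"
  by (rule trans[OF all_twist(1)], rule ball_cong[OF refl], rule trans[OF all_twist(1)],
      rule ball_cong[OF refl], rule all_twist(2))

section \<open>Twisted matched pair equations\<close>

lemma matched_l_iff:
  "(\<forall>x\<in>V. \<forall>a\<in>W. \<forall>b\<in>W. l (\<alpha> x) (n a b) =
      - l (l' a x - r' a x) (\<beta> b) + n (l x a - r x a) (\<beta> b) + r (r' b x) (\<beta> a) + n (\<beta> a) (l x b))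
   \<longleftrightarrow> u.cocycle"
  unfolding u.matched_l_cocycle[symmetric] u.matched_l_def
  by (rule trans[OF _ all_twist_VWW[symmetric]])
    (intro ball_cong refl, simp add: untwist equivariant)

lemma matched_r_iff:
  "(\<forall>x\<in>V. \<forall>y\<in>V. \<forall>a\<in>W. r' (\<beta> a) (commutator m x y) =
      r' (l y a) (\<alpha> x) - r' (l x a) (\<alpha> y) + m (\<alpha> x) (r' a y) - m (\<alpha> y) (r' a x))
   \<longleftrightarrow> u.cocycle"
  unfolding u.matched_r_cocycle[symmetric] u.matched_r_def
  by (rule trans[OF _ all_twist_VVW[symmetric]])
    (intro ball_cong refl, simp add: untwist equivariant commutator_def)

end

section \<open>The cocycle condition\<close>

lemma (in fd_vspace) transpose_linear:
  assumes "linear_on scale scale V V f"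
  shows "linear_on fun_scale fun_scale (dual scale V) (dual scale V) (transpose_on V f)"
  using assms closed_V
  by (auto simp: linear_on_def dual_def transpose_on_def fun_scale_def fun_eq_iff)

lemma (in fd_vspace) tensor_map_linear:
  assumes "linear_on scale scale V V f" "linear_on scale scale V V g"
  shows "linear_on tensor_scale tensor_scale (tensor_square scale V) (tensor_square scale V)
    (tensor_map scale V f g)"
proof -
  interpret f: vector_space "fun_scale :: 'k \<Rightarrow> ('v \<Rightarrow> 'k) \<Rightarrow> _"
    by (rule vector_space_fun_scale)
  note * = linear_onD[OF transpose_linear[OF assms(1)]] linear_onD[OF transpose_linear[OF assms(2)]]
    f.subspace_add[OF subspace_dual] f.subspace_scale[OF subspace_dual]
  have "tensor_map scale V f g t \<in> tensor_square scale V" if "t \<in> tensor_square scale V" for t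
    using that by (simp add: tensor_square_def tensor_map_def bilinear_on_def linear_on_def *)
  then show ?thesis
    by (auto simp: linear_on_def tensor_map_def tensor_scale_def fun_eq_iff)
qed

section \<open>Tensors evaluated on functionals\<close>

context hom_dual_pair
begin

text \<open>Realises \<open>W\<close> as the dual of \<open>V\<close>. It is the identity when
  \<open>W\<close> is the dual space itself, and the embedding into the bidual when the roles are
  exchanged.\<close>

definition functional where "functional a = (\<lambda>x. if x \<in> V then p x a else 0)"

lemma dual_eq: "dual sV V = functional ` W"
  using dual_bij by (simp add: bij_betw_def functional_def[abs_def])

lemma functional_dual [simp]: "a \<in> W \<Longrightarrow> functional a \<in> dual sV V"
  by (simp add: dual_eq)

lemma functional_linear:
  "\<lbrakk>a \<in> W; b \<in> W\<rbrakk> \<Longrightarrow> functional (a + b) = functional a + functional b"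
  "a \<in> W \<Longrightarrow> functional (sW c a) = fun_scale c (functional a)"
  by (auto simp: functional_def fun_scale_def pairing_add pairing_scale)

lemma transpose_functional:
  assumes "\<And>x. x \<in> V \<Longrightarrow> f x \<in> V" "\<And>x. x \<in> V \<Longrightarrow> p (f x) a = p x b"
  shows "transpose_on V f (functional a) = functional b"
  using assms by (auto simp: functional_def transpose_on_def)

lemma tensor_eqI:
  assumes "t \<in> tensor_square sV V" "u \<in> tensor_square sV V"
    "\<And>a b. \<lbrakk>a \<in> W; b \<in> W\<rbrakk> \<Longrightarrow> t (functional a) (functional b) = u (functional a) (functional b)"
  shows "t = u"
proof (intro ext)
  fix \<xi> \<eta> show "t \<xi> \<eta> = u \<xi> \<eta>"
    using assms by (cases "\<xi> \<in> dual sV V \<and> \<eta> \<in> dual sV V") (auto simp: tensor_square_def dual_eq)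
qed

lemma tensor_biadditive:
  assumes t: "t \<in> tensor_square sV V" and W: "a \<in> W" "b \<in> W" "c \<in> W"
  shows "t (functional (a + b)) (functional c) = t (functional a) (functional c) + t (functional b) (functional c)"
    "t (functional c) (functional (a + b)) = t (functional c) (functional a) + t (functional c) (functional b)"
    "t (functional (a - b)) (functional c) = t (functional a) (functional c) - t (functional b) (functional c)"
    "t (functional c) (functional (a - b)) = t (functional c) (functional a) - t (functional c) (functional b)"
    "t (functional (- a)) (functional c) = - t (functional a) (functional c)"
    "t (functional c) (functional (- a)) = - t (functional c) (functional a)"
    "t (functional (sW k a)) (functional c) = k * t (functional a) (functional c)"
    "t (functional c) (functional (sW k a)) = k * t (functional c) (functional a)"
proof -
  have bil: "bilinear_on fun_scale fun_scale (*) (dual sV V) (dual sV V) UNIV t"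
    using t by (simp add: tensor_square_def)
  have add: "t (functional (a + b)) (functional c) = t (functional a) (functional c) + t (functional b) (functional c)"
    "t (functional c) (functional (a + b)) = t (functional c) (functional a) + t (functional c) (functional b)"
    if "a \<in> W" "b \<in> W" for a b
    using that W bilinear_on_add[OF bil] by (simp_all add: functional_linear)
  then show "t (functional (a + b)) (functional c) = t (functional a) (functional c) + t (functional b) (functional c)"
    "t (functional c) (functional (a + b)) = t (functional c) (functional a) + t (functional c) (functional b)"
    using W by simp_all
  have "t (functional 0) (functional c) = 0" "t (functional c) (functional 0) = 0"
    using add[of 0 0] by (metis add_cancel_right_right add_0 W.closed_V(1))+
  then show "t (functional (- a)) (functional c) = - t (functional a) (functional c)"
    "t (functional c) (functional (- a)) = - t (functional c) (functional a)"
    using W add[of "- a" a] by (simp_all add: eq_neg_iff_add_eq_0)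
  show "t (functional (a - b)) (functional c) = t (functional a) (functional c) - t (functional b) (functional c)"
    "t (functional c) (functional (a - b)) = t (functional c) (functional a) - t (functional c) (functional b)"
    using W add[of "a - b" b] by simp_all
  show "t (functional (sW k a)) (functional c) = k * t (functional a) (functional c)"
    "t (functional c) (functional (sW k a)) = k * t (functional c) (functional a)"
    using W bilinear_on_scale[OF bil] by (simp_all add: functional_linear)
qed

text \<open>The transposes of \<open>L\<^sup>-\<^sup>2\<^sub>x\<close> and \<open>ad\<^sup>-\<^sup>2\<^sub>x\<close>, under the identification of \<open>W\<close> with the dual of \<open>V\<close>.\<close>

definition left_transpose where
  "left_transpose x a = ru (ai (ai x)) (bi a) - lu (ai (ai x)) (bi a)"

definition ad_transpose where
  "ad_transpose x a = - lu (ai (ai x)) (bi a)"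

lemma transpose_closed [simp]:
  "\<lbrakk>x \<in> V; a \<in> W\<rbrakk> \<Longrightarrow> left_transpose x a \<in> W" "\<lbrakk>x \<in> V; a \<in> W\<rbrakk> \<Longrightarrow> ad_transpose x a \<in> W"
  by (simp_all add: left_transpose_def ad_transpose_def)

lemma mult_linear: "x \<in> V \<Longrightarrow> linear_on sV sV V V (m x)"
  "x \<in> V \<Longrightarrow> linear_on sV sV V V (commutator m x)"
  using bilinear_onD(1)[OF V.mult_bilinear]
    bilinear_onD(1)[OF hom_lie_algebra.bracket_bilinear[OF V.sub_adjacent]] by auto

text \<open>The parameter \<open>i2\<close> is any function agreeing on \<open>V\<close> with the
  inverse square of \<alpha>. The two halves of the bialgebra condition write it differently:
  \<open>inv \<alpha> ^^ 2\<close> for the algebra, the transpose of \<open>\<alpha> ^^ 2\<close>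
  for its dual.\<close>

lemma tensor_action_closed:
  assumes "x \<in> V" "t \<in> tensor_square sV V" "\<And>x. x \<in> V \<Longrightarrow> i2 x = ai (ai x)"
  shows "tensor_action sV V m \<alpha> i2 x t \<in> tensor_square sV V"
proof -
  interpret T: vector_space "tensor_scale :: 'k \<Rightarrow> (('v \<Rightarrow> 'k) \<Rightarrow> ('v \<Rightarrow> 'k) \<Rightarrow> 'k) \<Rightarrow> _"
    by (rule vector_space_tensor_scale)
  show ?thesis using assms
    by (auto simp: tensor_action_def intro!: T.subspace_add[OF V.subspace_tensor_square]
        linear_onD(1)[OF V.tensor_map_linear] mult_linear V.alpha_linear)
qed

lemma tensor_twist_apply:
  assumes "a \<in> W" "b \<in> W"
  shows "tensor_map sV V \<alpha> \<alpha> t (functional a) (functional b) = t (functional (bi a)) (functional (bi b))"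
  using assms by (simp add: tensor_map_def transpose_functional[where b = "bi _"] pairing_alpha)

text \<open>A tensor is a bilinear form on functionals, so an operator acts by precomposition with
  its transpose; under \<open>functional\<close> the transpose of \<alpha> is
  \<open>bi\<close>.\<close>

lemma tensor_action_apply:
  assumes "x \<in> V" "i2 x = ai (ai x)" "a \<in> W" "b \<in> W"
  shows "tensor_action sV V m \<alpha> i2 x t (functional a) (functional b) =
    t (functional (left_transpose x a)) (functional (bi b)) +
    t (functional (bi a)) (functional (ad_transpose x b))"
proof -
  let ?x = "ai (ai x)"
  have "transpose_on V \<alpha> (functional c) = functional (bi c)" if "c \<in> W" for c
    using that by (simp add: transpose_functional pairing_alpha)
  moreover have "transpose_on V (m ?x) (functional a) = functional (left_transpose x a)"
    using assms by (intro transpose_functional)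
      (simp_all add: left_transpose_def untwist(1) pairing_alpha pairing_diff u.adjoint)
  moreover have "transpose_on V (commutator m ?x) (functional b) = functional (ad_transpose x b)"
    using assms by (intro transpose_functional)
      (simp_all add: ad_transpose_def commutator_def untwist(1) pairing_alpha pairing_diff u.adjoint u.p_minus)
  ultimately show ?thesis
    using assms by (simp add: tensor_action_def tensor_map_def)
qed

lemma bi_actions: "\<lbrakk>x \<in> V; a \<in> W\<rbrakk> \<Longrightarrow> bi (lu x a) = lu (ai x) (bi a)"
  "\<lbrakk>x \<in> V; a \<in> W\<rbrakk> \<Longrightarrow> bi (ru x a) = ru (ai x) (bi a)"
  using beta_lu[of "ai x" "bi a"] beta_ru[of "ai x" "bi a"] bi(3)
  by (metis ai(1,2) bi(1,2) u.op_closed(3)) (metis ai(1,2) bi(1,2) u.op_closed(4) beta_ru bi(3))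

lemma ai_mu: "\<lbrakk>x \<in> V; y \<in> V\<rbrakk> \<Longrightarrow> ai (mu x y) = mu (ai x) (ai y)"
  by (metis ai alpha_mu u.op_closed(1))

lemma bi_nu: "\<lbrakk>x \<in> W; y \<in> W\<rbrakk> \<Longrightarrow> bi (nu x y) = nu (bi x) (bi y)"
  by (metis bi beta_nu u.op_closed(2))

lemmas equivariant_inv = bi_actions ai_mu bi_nu ai_diff bi_diff ai_add bi_add bi_minus

text \<open>The Hom-bracket relations of the two factors of the tensor action, transposed; hence the
  reversed order of composition. They are \<open>lr_bracket\<close> and \<open>l_bracket\<close> at
  twice untwisted arguments.\<close>

lemma transpose_bracket:
  assumes "x \<in> V" "y \<in> V" "a \<in> W"
  shows "bi (left_transpose (commutator m x y) a) =
      left_transpose y (left_transpose (\<alpha> x) a) - left_transpose x (left_transpose (\<alpha> y) a)"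
    "bi (ad_transpose (commutator m x y) a) =
      ad_transpose y (ad_transpose (\<alpha> x) a) - ad_transpose x (ad_transpose (\<alpha> y) a)"
proof -
  \<comment> \<open>Two inverse twists come from the definition of the transposes and the third from
    the outer \<open>bi\<close>; one of them is spent on the \<alpha> hidden in
    \<open>m\<close>.\<close>
  have c: "ai (ai (ai (commutator m x y))) = mu (ai (ai x)) (ai (ai y)) - mu (ai (ai y)) (ai (ai x))"
    using assms by (simp add: commutator_def untwist(1) V.alpha_diff[symmetric] equivariant_inv)
  show "bi (left_transpose (commutator m x y) a) =
      left_transpose y (left_transpose (\<alpha> x) a) - left_transpose x (left_transpose (\<alpha> y) a)"
    using assms u.lr_bracket[of "ai (ai x)" "ai (ai y)" "bi (bi a)"]
    by (simp add: left_transpose_def equivariant_inv c)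
  show "bi (ad_transpose (commutator m x y) a) =
      ad_transpose y (ad_transpose (\<alpha> x) a) - ad_transpose x (ad_transpose (\<alpha> y) a)"
    using assms u.l_bracket[of "ai (ai x)" "ai (ai y)" "bi (bi a)"]
    by (simp add: ad_transpose_def equivariant_inv c u.action_additive)
qed

lemma transpose_twist:
  assumes "x \<in> V" "a \<in> W"
  shows "bi (left_transpose (\<alpha> x) a) = left_transpose x (bi a)"
    "bi (ad_transpose (\<alpha> x) a) = ad_transpose x (bi a)"
  using assms by (simp_all add: left_transpose_def ad_transpose_def equivariant_inv)

lemma transpose_linear_arg:
  assumes "x \<in> V" "y \<in> V" "a \<in> W"
  shows "left_transpose (x + y) a = left_transpose x a + left_transpose y a"
    "ad_transpose (x + y) a = ad_transpose x a + ad_transpose y a"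
    "left_transpose (sV c x) a = sW c (left_transpose x a)"
    "ad_transpose (sV c x) a = sW c (ad_transpose x a)"
  using assms by (simp_all add: left_transpose_def ad_transpose_def equivariant_inv ai_scale
      action_scale u.action_additive W.scale_right_diff_distrib W.scale_minus_right)

text \<open>On a pair of functionals, the mixed terms, where one element acts on each factor, are
  symmetric in \<open>x\<close> and \<open>y\<close> and cancel. The remaining terms are matched by
  \<open>transpose_bracket\<close>, one factor at a time.\<close>

lemma tensor_representation:
  assumes i2: "\<And>x. x \<in> V \<Longrightarrow> i2 x = ai (ai x)"
  shows "hom_lie_representation sV V (commutator m) \<alpha> tensor_scale (tensor_square sV V)
    (tensor_map sV V \<alpha> \<alpha>) (tensor_action sV V m \<alpha> i2)"
proof -
  interpret C: hom_lie_algebra sV V "commutator m" \<alpha> by (rule V.sub_adjacent)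
  interpret T: fd_vspace tensor_scale "tensor_square sV V" by (rule V.tensor_square_fd)
  let ?\<rho> = "tensor_action sV V m \<alpha> i2" and ?T = "tensor_square sV V"
  have closed [simp]: "?\<rho> x t \<in> ?T" if "x \<in> V" "t \<in> ?T" for x t
    using tensor_action_closed[OF that] i2 by blast
  have twist_lin: "linear_on tensor_scale tensor_scale ?T ?T (tensor_map sV V \<alpha> \<alpha>)"
    by (intro V.tensor_map_linear V.alpha_linear)
  note [simp] = linear_onD(1)[OF twist_lin] T.closed_V
  note at = tensor_action_apply i2 tensor_twist_apply
  show ?thesis
  proof unfold_locales
    show "linear_on tensor_scale tensor_scale ?T ?T (tensor_map sV V \<alpha> \<alpha>)" by (rule twist_lin)
    show "bilinear_on sV tensor_scale tensor_scale V ?T ?T ?\<rho>"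
      unfolding bilinear_on_def linear_on_def
      by (intro conjI ballI allI; (simp; fail)?; rule tensor_eqI; (simp; fail)?;
          simp add: tensor_scale_def at tensor_biadditive transpose_linear_arg algebra_simps)
    fix x t assume x: "x \<in> V" and t: "t \<in> ?T"
    show "?\<rho> (\<alpha> x) (tensor_map sV V \<alpha> \<alpha> t) = tensor_map sV V \<alpha> \<alpha> (?\<rho> x t)"
      by (rule tensor_eqI) (use x t in \<open>simp_all add: at transpose_twist\<close>)
    fix y assume y: "y \<in> V"
    show "?\<rho> (commutator m x y) (tensor_map sV V \<alpha> \<alpha> t) =
        ?\<rho> (\<alpha> x) (?\<rho> y t) - ?\<rho> (\<alpha> y) (?\<rho> x t)"
      by (rule tensor_eqI)
        (use x y t in \<open>simp_all add: at transpose_twist transpose_bracket tensor_biadditive\<close>)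
  qed
qed

text \<open>The two sides of the cocycle equation, evaluated at \<open>a\<close> and
  \<open>b\<close>, differ by the untwisted defect at the same arguments: all twists disappear by
  the invariance of \<open>p\<close>.\<close>

lemma cocycle_iff:
  assumes i2: "\<And>x. x \<in> V \<Longrightarrow> i2 x = ai (ai x)"
    and \<Delta>: "\<And>x. x \<in> V \<Longrightarrow> \<Delta> x \<in> tensor_square sV V"
      "\<And>x a b. \<lbrakk>x \<in> V; a \<in> W; b \<in> W\<rbrakk> \<Longrightarrow> \<Delta> x (functional a) (functional b) = p x (n a b)"
  shows "hom_lie_cocycle sV V (commutator m) \<alpha> tensor_scale (tensor_square sV V)
    (tensor_map sV V \<alpha> \<alpha>) (tensor_action sV V m \<alpha> i2) \<Delta> \<longleftrightarrow> u.cocycle"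
proof -
  interpret R: hom_lie_representation sV V "commutator m" \<alpha> tensor_scale "tensor_square sV V"
    "tensor_map sV V \<alpha> \<alpha>" "tensor_action sV V m \<alpha> i2"
    using i2 by (rule tensor_representation)
  let ?\<rho> = "tensor_action sV V m \<alpha> i2" and ?T = "tensor_square sV V"
  note [simp] = R.rep.closed_V \<Delta> tensor_action_closed[OF _ _ i2]
  have lin: "linear_on sV tensor_scale V ?T \<Delta>"
    unfolding linear_on_def
    by (intro conjI ballI allI; (simp; fail)?; rule tensor_eqI; (simp; fail)?;
        simp add: tensor_scale_def pairing_add pairing_scale)
  have "\<Delta> (commutator m x y) = ?\<rho> (\<alpha> x) (\<Delta> y) - ?\<rho> (\<alpha> y) (\<Delta> x) \<longleftrightarrow>
    (\<forall>a\<in>W. \<forall>b\<in>W. u.cocycle_defect x y a b = 0)" (is "?L = ?R \<longleftrightarrow> _")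
    if x: "x \<in> V" and y: "y \<in> V" for x y
  proof -
    have *: "?L (functional a) (functional b) - ?R (functional a) (functional b) = u.cocycle_defect x y a b"
      if a: "a \<in> W" and b: "b \<in> W" for a b
    proof -
      have pb: "p z (\<beta> c) = p (ai z) c" if "z \<in> V" "c \<in> W" for z c
        using that by (simp add: pairing_ai)
      have n: "p z (n c (bi d)) = p (ai z) (nu c (bi d))" "p z (n (bi c) d) = p (ai z) (nu (bi c) d)"
        if "z \<in> V" "c \<in> W" "d \<in> W" for z c d
        using that by (simp_all add: untwist(2) pb)
      \<comment> \<open>By equivariance one inverse twist can be taken out of each second argument,
        where it cancels against the one on \<open>x\<close>.\<close>
      have t: "p (ai x) (nu (ru (ai y) (bi a) - lu (ai y) (bi a)) (bi b)) = p x (nu (ru y a - lu y a) b)"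
        "p (ai x) (nu (bi a) (- lu (ai y) (bi b))) = - p x (nu a (lu y b))"
        if "x \<in> V" "y \<in> V" for x y
      proof -
        have inv: "p (ai x) (bi c) = p x c" if "c \<in> W" for c
          using \<open>x \<in> V\<close> that by (simp add: pairing_ai)
        have "p (ai x) (nu (ru (ai y) (bi a) - lu (ai y) (bi a)) (bi b)) = p (ai x) (bi (nu (ru y a - lu y a) b))"
          using that a b by (simp add: equivariant_inv)
        then show "p (ai x) (nu (ru (ai y) (bi a) - lu (ai y) (bi a)) (bi b)) = p x (nu (ru y a - lu y a) b)"
          using that a b by (simp add: inv)
        have "p (ai x) (nu (bi a) (- lu (ai y) (bi b))) = - p (ai x) (bi (nu a (lu y b)))"
          using that a b by (simp add: equivariant_inv u.n_minus u.p_minus)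
        then show "p (ai x) (nu (bi a) (- lu (ai y) (bi b))) = - p x (nu a (lu y b))"
          using that a b by (simp add: inv)
      qed
      have "p (commutator m x y) (n a b) = p (mu x y - mu y x) (nu a b)"
        using x y a b by (simp add: commutator_def untwist(1,2) V.alpha_diff[symmetric] pairing_twist)
      then show ?thesis
        using x y a b
        by (simp add: tensor_action_apply i2 left_transpose_def ad_transpose_def u.cocycle_defect_def n t)
    qed
    have "?L = ?R \<longleftrightarrow> (\<forall>a\<in>W. \<forall>b\<in>W. ?L (functional a) (functional b) = ?R (functional a) (functional b))"
      using tensor_eqI[of ?L ?R] x y by (metis V.alpha_closed V.commutator_closed R.rep.closed_V(3) \<Delta>(1) tensor_action_closed[OF _ _ i2])
    then show ?thesis using * by (metis eq_iff_diff_eq_0)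
  qed
  then have "(\<forall>x\<in>V. \<forall>y\<in>V. \<Delta> (commutator m x y) = ?\<rho> (\<alpha> x) (\<Delta> y) - ?\<rho> (\<alpha> y) (\<Delta> x)) \<longleftrightarrow> u.cocycle"
    unfolding u.cocycle_def by blast
  then show ?thesis
    unfolding hom_lie_cocycle_def hom_lie_cocycle_axioms_def
    using lin R.hom_lie_representation_axioms by blast
qed

end

section \<open>Matched pairs and Manin triples\<close>

lemma vector_space_prod_scale:
  assumes "vector_space s" "vector_space t"
  shows "vector_space (prod_scale s t)"
proof -
  interpret s: vector_space s by fact
  interpret t: vector_space t by fact
  show ?thesis
    by unfold_locales (auto simp: prod_scale_def s.scale_left_distrib s.scale_right_distrib
        t.scale_left_distrib t.scale_right_distrib)
qed

lemma fd_vspace_Times: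
  assumes "fd_vspace s V" "fd_vspace t W"
  shows "fd_vspace (prod_scale s t) (V \<times> W)"
proof -
  interpret V: fd_vspace s V by fact
  interpret W: fd_vspace t W by fact
  interpret P: vector_space "prod_scale s t"
    by (intro vector_space_prod_scale V.vector_space_axioms W.vector_space_axioms)
  obtain B C where B: "finite B" "V.span B = V" and C: "finite C" "W.span C = W"
    using V.finitely_spanned W.finitely_spanned by blast
  define S where "S = (\<lambda>x. (x, 0)) ` B \<union> (\<lambda>a. (0, a)) ` C"
  have "P.subspace (V \<times> W)"
    by (rule P.subspaceI) (auto simp: prod_scale_def V.closed_V W.closed_V zero_prod_def)
  moreover have "S \<subseteq> V \<times> W"
    using B C V.span_superset[of B] W.span_superset[of C]
    by (auto simp: S_def V.closed_V W.closed_V)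
  ultimately have "P.span S \<subseteq> V \<times> W" by (rule P.span_minimal[rotated])
  moreover have "(x, 0) \<in> P.span S" if "x \<in> V" for x
  proof -
    \<comment> \<open>The slice of the span along the first factor is a subspace containing the
      spanning set \<open>B\<close>, hence all of \<open>V\<close>.\<close>
    have "V.subspace {x. (x, 0) \<in> P.span S}"
      using P.span_zero[of S] P.span_add[of "(_, 0)" S "(_, 0)"] P.span_scale[of "(_, 0)" S]
      by (auto intro!: V.subspaceI simp: zero_prod_def prod_scale_def)
    moreover have "B \<subseteq> {x. (x, 0) \<in> P.span S}" by (auto simp: S_def intro: P.span_base)
    ultimately show ?thesis using V.span_minimal that B(2) by blast
  qed
  moreover have "(0, a) \<in> P.span S" if "a \<in> W" for a
  proof -
    have "W.subspace {a. (0, a) \<in> P.span S}"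
      using P.span_zero[of S] P.span_add[of "(0, _)" S "(0, _)"] P.span_scale[of "(0, _)" S]
      by (auto intro!: W.subspaceI simp: zero_prod_def prod_scale_def)
    moreover have "C \<subseteq> {a. (0, a) \<in> P.span S}" by (auto simp: S_def intro: P.span_base)
    ultimately show ?thesis using W.span_minimal that C(2) by blast
  qed
  ultimately have "P.span S = V \<times> W"
    using P.span_add[of "(_, 0)" S "(0, _)"] by fastforce
  moreover have "finite S" using B C by (simp add: S_def)
  ultimately show ?thesis by unfold_locales blast
qed

lemma (in vector_space) fd_vspace_zero: "fd_vspace scale {0}"
  by unfold_locales (metis finite.emptyI span_empty)

context hom_dual_pair
begin

text \<open>Makes the conditions produced by the swapped pair syntactically comparable with those
  stated in the operations of this one.\<close>

lemma swapped_untwisted: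
  "hom_dual_pair.mu W n \<beta> = nu" "hom_dual_pair.nu V m \<alpha> = mu"
  "hom_dual_pair.lu V \<alpha> l' = lu'" "hom_dual_pair.ru V \<alpha> r' = ru'"
  "hom_dual_pair.lu' W \<beta> l = lu" "hom_dual_pair.ru' W \<beta> r = ru"
proof -
  interpret s: hom_dual_pair sW W n \<beta> sV V m \<alpha> "\<lambda>a x. p x a" l' r' l r by (rule swap)
  show "s.mu = nu" "s.nu = mu" "s.lu = lu'" "s.ru = ru'" "s.lu' = lu" "s.ru' = ru"
    by (simp_all add: fun_eq_iff s.mu_def nu_def s.nu_def mu_def s.lu_def lu'_def s.ru_def ru'_def
        s.lu'_def lu_def s.ru'_def ru_def s.ai_def bi_def s.bi_def ai_def)
qed

abbreviation "dual_cocycle \<equiv> dual_pre_lie.cocycle W V (\<lambda>a x. p x a) nu mu lu' ru'"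

text \<open>Both representation conditions hold automatically. The equations for
  \<open>l\<^sub>A\<close> and \<open>r\<^sub>B\<close> each amount to the first cocycle condition,
  those for \<open>l\<^sub>B\<close> and \<open>r\<^sub>A\<close> to the second.\<close>

lemma matched_pair_iff:
  "hom_pre_lie_matched_pair sV V m \<alpha> sW W n \<beta> l r l' r' \<longleftrightarrow> u.cocycle \<and> dual_cocycle"
proof -
  interpret s: hom_dual_pair sW W n \<beta> sV V m \<alpha> "\<lambda>a x. p x a" l' r' l r by (rule swap)
  have "hom_pre_lie_matched_pair_axioms V m \<alpha> W n \<beta> l r l' r' \<longleftrightarrow> u.cocycle \<and> dual_cocycle"
    using matched_l_iff matched_r_iff s.matched_l_iff[unfolded swapped_untwisted]
      s.matched_r_iff[unfolded swapped_untwisted]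
    unfolding hom_pre_lie_matched_pair_axioms_def by blast
  then show ?thesis
    unfolding hom_pre_lie_matched_pair_def using representation s.representation by blast
qed

section \<open>The twisted double and its form\<close>

definition hom_double where
  "hom_double = (\<lambda>(x, a) (y, b). (m x y + l' a y + r' b x, n a b + l x b + r y a))"

definition pair_form where
  "pair_form = (\<lambda>(x, a) (y, b). p y a - p x b)"

abbreviation "twist \<equiv> map_prod \<alpha> \<beta>"

lemma hom_double_untwist:
  "\<lbrakk>u \<in> V \<times> W; v \<in> V \<times> W\<rbrakk> \<Longrightarrow> hom_double u v = twist (u.double u v)"
  by (auto simp: hom_double_def u.double_simps untwist V.alpha_add W.alpha_add)

lemma twist_double:
  "\<lbrakk>u \<in> V \<times> W; v \<in> V \<times> W\<rbrakk> \<Longrightarrow> twist (u.double u v) = u.double (twist u) (twist v)"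
  by (auto simp: u.double_simps equivariant)

lemma double_closed: "\<lbrakk>u \<in> V \<times> W; v \<in> V \<times> W\<rbrakk> \<Longrightarrow> u.double u v \<in> V \<times> W"
  by (auto simp: u.double_simps)

lemma twist_closed: "u \<in> V \<times> W \<Longrightarrow> twist u \<in> V \<times> W"
  by auto

lemma twist_diff: "\<lbrakk>u \<in> V \<times> W; v \<in> V \<times> W\<rbrakk> \<Longrightarrow> twist (u - v) = twist u - twist v"
  by (auto simp: V.alpha_diff W.alpha_diff)

lemma twist_bij: "bij_betw twist (V \<times> W) (V \<times> W)"
  using V.regular W.regular by (rule bij_betw_map_prod)

lemma Times_diff_closed: "\<lbrakk>u \<in> V \<times> W; v \<in> V \<times> W\<rbrakk> \<Longrightarrow> u - v \<in> V \<times> W"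
  by (cases u; cases v) simp

text \<open>Both sides are the untwisted expressions with \<open>twist\<close> applied twice, and
  \<open>twist\<close> is injective on \<open>V \<times> W\<close>.\<close>

lemma hom_double_pre_lie_iff:
  "(\<forall>u\<in>V \<times> W. \<forall>v\<in>V \<times> W. \<forall>w\<in>V \<times> W.
    hom_double (hom_double u v) (twist w) - hom_double (twist u) (hom_double v w) =
    hom_double (hom_double v u) (twist w) - hom_double (twist v) (hom_double u w))
   \<longleftrightarrow> u.cocycle \<and> dual_cocycle"
proof -
  note closed = double_closed twist_closed Times_diff_closed
  have inj: "twist u = twist v \<longleftrightarrow> u = v" if "u \<in> V \<times> W" "v \<in> V \<times> W" for u v
    using bij_betw_imp_inj_on[OF twist_bij] that by (auto dest: inj_onD)
  have "hom_double (hom_double u v) (twist w) - hom_double (twist u) (hom_double v w) =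
      twist (twist (u.double (u.double u v) w - u.double u (u.double v w)))"
    if "u \<in> V \<times> W" "v \<in> V \<times> W" "w \<in> V \<times> W" for u v w
    using that by (simp only: hom_double_untwist twist_double twist_diff closed)
  then have "hom_double (hom_double u v) (twist w) - hom_double (twist u) (hom_double v w) =
      hom_double (hom_double v u) (twist w) - hom_double (twist v) (hom_double u w) \<longleftrightarrow>
      u.double (u.double u v) w - u.double u (u.double v w) =
      u.double (u.double v u) w - u.double v (u.double u w)"
    if "u \<in> V \<times> W" "v \<in> V \<times> W" "w \<in> V \<times> W" for u v w
    using that by (simp only: inj closed)
  then show ?thesis
    unfolding u.double_pre_lie_iff[symmetric] by (intro ball_cong refl) blast
qed

text \<open>The part of the structure of the double that holds for every dual pair, without the
  cocycle conditions.\<close>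

lemma double_structure:
  "fd_vspace (prod_scale sV sW) (V \<times> W)"
  "bilinear_on (prod_scale sV sW) (prod_scale sV sW) (prod_scale sV sW) (V \<times> W) (V \<times> W) (V \<times> W) hom_double"
  "linear_on (prod_scale sV sW) (prod_scale sV sW) (V \<times> W) (V \<times> W) twist"
  "\<lbrakk>u \<in> V \<times> W; v \<in> V \<times> W\<rbrakk> \<Longrightarrow> twist (hom_double u v) = hom_double (twist u) (twist v)"
proof -
  interpret s: hom_dual_pair sW W n \<beta> sV V m \<alpha> "\<lambda>a x. p x a" l' r' l r by (rule swap)
  interpret R: hom_pre_lie_representation sV V m \<alpha> sW W \<beta> l r by (rule representation)
  interpret R': hom_pre_lie_representation sW W n \<beta> sV V \<alpha> l' r' by (rule s.representation)
  show "fd_vspace (prod_scale sV sW) (V \<times> W)"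
    by (intro fd_vspace_Times V.fd_vspace_axioms W.fd_vspace_axioms)
  note add = bilinear_on_add[OF R.rho_linear] bilinear_on_add[OF R.mu_linear]
    bilinear_on_add[OF R'.rho_linear] bilinear_on_add[OF R'.mu_linear]
  note scl = bilinear_on_scale[OF R.rho_linear] bilinear_on_scale[OF R.mu_linear]
    bilinear_on_scale[OF R'.rho_linear] bilinear_on_scale[OF R'.mu_linear]
  show "bilinear_on (prod_scale sV sW) (prod_scale sV sW) (prod_scale sV sW) (V \<times> W) (V \<times> W) (V \<times> W) hom_double"
    by (auto simp: bilinear_on_def linear_on_def hom_double_def prod_scale_def add scl
        V.mult_add W.mult_add V.mult_scale W.mult_scale V.scale_right_distrib W.scale_right_distrib
        algebra_simps)
  show "linear_on (prod_scale sV sW) (prod_scale sV sW) (V \<times> W) (V \<times> W) twist"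
    by (auto simp: linear_on_def prod_scale_def V.alpha_add W.alpha_add V.alpha_scale W.alpha_scale)
  show "twist (hom_double u v) = hom_double (twist u) (twist v)" if "u \<in> V \<times> W" "v \<in> V \<times> W"
    using that by (simp only: hom_double_untwist twist_double double_closed twist_closed)
qed

text \<open>Each form value pairs two twisted vectors and \<open>twist\<close> preserves the form,
  so the claim reduces to the untwisted invariance.\<close>

lemma pair_form_invariant:
  assumes "u \<in> V \<times> W" "v \<in> V \<times> W" "w \<in> V \<times> W"
  shows "pair_form (hom_double u v) (twist w) = - pair_form (twist v) (commutator hom_double u w)"
proof -
  have f: "pair_form (twist u) (twist v) = p (fst v) (snd u) - p (fst u) (snd v)"
    if "u \<in> V \<times> W" "v \<in> V \<times> W" for u v
    using that by (auto simp: pair_form_def pairing_twist)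
  have "pair_form (hom_double u v) (twist w) = p (fst w) (snd (u.double u v)) - p (fst (u.double u v)) (snd w)"
    using assms by (simp only: hom_double_untwist f double_closed)
  also have "\<dots> = - pair_form (twist v) (twist (u.double u w - u.double w u))"
    using u.double_form_invariant[OF assms] assms by (simp only: f double_closed Times_diff_closed)
  also have "twist (u.double u w - u.double w u) = commutator hom_double u w"
    using assms by (simp only: commutator_def hom_double_untwist twist_diff double_closed)
  finally show ?thesis .
qed

section \<open>The two summands and the Manin triple\<close>

lemma first_summand:
  "regular_hom_pre_lie_algebra (prod_scale sV sW) (V \<times> {0})
    (\<lambda>u v. (m (fst u) (fst v), 0)) (\<lambda>u. (\<alpha> (fst u), 0))"
proof -
  have "fd_vspace (prod_scale sV sW) (V \<times> {0})"
    by (intro fd_vspace_Times V.fd_vspace_axioms W.fd_vspace_zero)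
  then interpret P: fd_vspace "prod_scale sV sW" "V \<times> {0}" .
  have "bij_betw (\<lambda>u. (\<alpha> (fst u), 0)) (V \<times> {0}) (V \<times> {0})"
    by (rule bij_betw_byWitness[where f' = "\<lambda>u. (ai (fst u), 0)"]) auto
  then show ?thesis
    using V.hom_pre_lie
    by unfold_locales (auto simp: bilinear_on_def linear_on_def prod_scale_def V.mult_add V.mult_scale
        V.alpha_add V.alpha_scale V.alpha_mult)
qed

lemma second_summand:
  "regular_hom_pre_lie_algebra (prod_scale sV sW) ({0} \<times> W)
    (\<lambda>u v. (0, n (snd u) (snd v))) (\<lambda>u. (0, \<beta> (snd u)))"
proof -
  have "fd_vspace (prod_scale sV sW) ({0} \<times> W)"
    by (intro fd_vspace_Times W.fd_vspace_axioms V.fd_vspace_zero)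
  then interpret P: fd_vspace "prod_scale sV sW" "{0} \<times> W" .
  have "bij_betw (\<lambda>u. (0, \<beta> (snd u))) ({0} \<times> W) ({0} \<times> W)"
    by (rule bij_betw_byWitness[where f' = "\<lambda>u. (0, bi (snd u))"]) auto
  then show ?thesis
    using W.hom_pre_lie
    by unfold_locales (auto simp: bilinear_on_def linear_on_def prod_scale_def W.mult_add W.mult_scale
        W.alpha_add W.alpha_scale W.alpha_mult)
qed

text \<open>The cocycle conditions enter through the Hom-pre-Lie identity of
  \<open>hom_double\<close>; the remaining requirements are verified for an arbitrary dual
  pair.\<close>

lemma manin_triple_iff:
  "hom_pre_lie_manin_triple (prod_scale sV sW) (V \<times> W) hom_double twist pair_form
     (V \<times> {0}) (\<lambda>u v. (m (fst u) (fst v), 0)) (\<lambda>u. (\<alpha> (fst u), 0))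
     ({0} \<times> W) (\<lambda>u v. (0, n (snd u) (snd v))) (\<lambda>u. (0, \<beta> (snd u)))
   \<longleftrightarrow> u.cocycle \<and> dual_cocycle" (is "?M \<longleftrightarrow> _")
proof
  assume ?M
  then interpret M: hom_pre_lie_manin_triple "prod_scale sV sW" "V \<times> W" hom_double twist pair_form
     "V \<times> {0}" "\<lambda>u v. (m (fst u) (fst v), 0)" "\<lambda>u. (\<alpha> (fst u), 0)"
     "{0} \<times> W" "\<lambda>u v. (0, n (snd u) (snd v))" "\<lambda>u. (0, \<beta> (snd u))" .
  show "u.cocycle \<and> dual_cocycle"
    using M.hom_pre_lie hom_double_pre_lie_iff by blast
next
  assume c: "u.cocycle \<and> dual_cocycle"
  interpret s: hom_dual_pair sW W n \<beta> sV V m \<alpha> "\<lambda>a x. p x a" l' r' l r by (rule swap)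
  interpret D: fd_vspace "prod_scale sV sW" "V \<times> W" by (rule double_structure)
  interpret D: regular_hom_pre_lie_algebra "prod_scale sV sW" "V \<times> W" hom_double twist
    using hom_double_pre_lie_iff c
    by unfold_locales (use double_structure twist_bij in blast)+
  interpret D1: regular_hom_pre_lie_algebra "prod_scale sV sW" "V \<times> {0}"
     "\<lambda>u v. (m (fst u) (fst v), 0)" "\<lambda>u. (\<alpha> (fst u), 0)" by (rule first_summand)
  interpret D2: regular_hom_pre_lie_algebra "prod_scale sV sW" "{0} \<times> W"
     "\<lambda>u v. (0, n (snd u) (snd v))" "\<lambda>u. (0, \<beta> (snd u))" by (rule second_summand)
  interpret su: dual_pre_lie W V "\<lambda>a x. p x a" nu mu lu' ru' lu ru by (rule u.swap)
  have zero [simp]: "\<alpha> 0 = 0" "\<beta> 0 = 0"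
    using V.alpha_diff[of 0 0] W.alpha_diff[of 0 0] by simp_all
  show ?M
  proof unfold_locales
    show "bilinear_on (prod_scale sV sW) (prod_scale sV sW) (*) (V \<times> W) (V \<times> W) UNIV pair_form"
      by (auto simp: bilinear_on_def linear_on_def pair_form_def prod_scale_def pairing_add pairing_scale
          algebra_simps)
    show "u = 0" if u: "u \<in> V \<times> W" and z: "\<forall>v\<in>V \<times> W. pair_form u v = 0" for u
    proof -
      have "p y (snd u) = p y 0" if "y \<in> V" for y
        using u bspec[OF z, of "(y, 0)"] that by (auto simp: pair_form_def split_beta)
      moreover have "p (fst u) a = p 0 a" if "a \<in> W" for a
        using u bspec[OF z, of "(0, a)"] that by (auto simp: pair_form_def split_beta)
      ultimately show ?thesis
        using u separate[of "snd u" 0] s.separate[of "fst u" 0] by (auto simp: prod_eq_iff)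
    qed
    show "pair_form u v = - pair_form v u" for u v
      by (cases u; cases v) (simp add: pair_form_def)
    show "pair_form (twist u) (twist v) = pair_form u v" if "u \<in> V \<times> W" "v \<in> V \<times> W" for u v
      using that by (auto simp: pair_form_def pairing_twist)
    show "pair_form (hom_double u v) (twist w) = - pair_form (twist v) (commutator hom_double u w)"
      if "u \<in> V \<times> W" "v \<in> V \<times> W" "w \<in> V \<times> W" for u v w
      using that by (rule pair_form_invariant)
    show "(m (fst u) (fst v), 0) = hom_double u v" if "u \<in> V \<times> {0}" "v \<in> V \<times> {0}" for u v
      using that by (auto simp: hom_double_untwist u.double_simps untwist)
    show "(0, n (snd u) (snd v)) = hom_double u v" if "u \<in> {0} \<times> W" "v \<in> {0} \<times> W" for u v
      using that by (auto simp: hom_double_untwist u.double_simps untwist)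
    show "V \<times> W = {x + y |x y. x \<in> V \<times> {0} \<and> y \<in> {0} \<times> W}"
    proof (intro equalityI subsetI)
      fix u assume "u \<in> V \<times> W"
      then show "u \<in> {x + y |x y. x \<in> V \<times> {0} \<and> y \<in> {0} \<times> W}"
        by (intro CollectI exI[of _ "(fst u, 0)"] exI[of _ "(0, snd u)"]) auto
    qed auto
  qed (auto simp: pair_form_def zero_prod_def)
qed

end

section \<open>The dual space and evaluation as a dual pair\<close>

lemma standard_dual_pair:
  fixes scale :: "'k::field \<Rightarrow> 'a::ab_group_add \<Rightarrow> 'a"
    and mult :: "'a \<Rightarrow> 'a \<Rightarrow> 'a" and \<alpha> :: "'a \<Rightarrow> 'a"
    and circ :: "('a \<Rightarrow> 'k) \<Rightarrow> ('a \<Rightarrow> 'k) \<Rightarrow> ('a \<Rightarrow> 'k)"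
  assumes "regular_hom_pre_lie_algebra scale UNIV mult \<alpha>"
    and "regular_hom_pre_lie_algebra fun_scale (dual scale UNIV) circ (transpose_on UNIV (inv \<alpha>))"
  shows "hom_dual_pair scale UNIV mult \<alpha> fun_scale (dual scale UNIV) circ (transpose_on UNIV (inv \<alpha>))
    (\<lambda>x \<xi>. \<xi> x)
    (coadj_star UNIV \<alpha> (commutator mult))
    (\<lambda>x \<xi>. - coadj_star UNIV \<alpha> (right_mult mult) x \<xi>)
    (dual_coadj_star scale UNIV \<alpha> (commutator circ))
    (\<lambda>\<xi> x. - dual_coadj_star scale UNIV \<alpha> (right_mult circ) \<xi> x)"
proof -
  let ?D = "dual scale UNIV" and ?\<beta> = "transpose_on UNIV (inv \<alpha>)"
  interpret A: regular_hom_pre_lie_algebra scale UNIV mult \<alpha> by fact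
  interpret D: regular_hom_pre_lie_algebra fun_scale ?D circ ?\<beta> by fact
  have bij: "bij \<alpha>" by (rule A.regular)
  then have inv [simp]: "inv \<alpha> (\<alpha> x) = x" "\<alpha> (inv \<alpha> x) = x" for x
    by (simp_all add: bij_is_inj bij_is_surj surj_f_inv_f)
  have inv_linear: "inv \<alpha> (x + y) = inv \<alpha> x + inv \<alpha> y" "inv \<alpha> (scale c x) = scale c (inv \<alpha> x)" for x y c
    by (metis UNIV_I inv A.alpha_add) (metis UNIV_I inv A.alpha_scale)
  have lin: "\<xi> (x + y) = \<xi> x + \<xi> y" "\<xi> (x - y) = \<xi> x - \<xi> y" "\<xi> (scale c x) = c * \<xi> x" "\<xi> (- x) = - \<xi> x"
    if "\<xi> \<in> ?D" for \<xi> x y c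
  proof -
    show add: "\<xi> (x + y) = \<xi> x + \<xi> y" for x y using that by (simp add: dual_def linear_on_def)
    show diff: "\<xi> (x - y) = \<xi> x - \<xi> y" for x y using add[of "x - y" y] by simp
    show "\<xi> (- x) = - \<xi> x" using diff[of 0 x] diff[of 0 0] by simp
    show "\<xi> (scale c x) = c * \<xi> x" using that by (simp add: dual_def linear_on_def)
  qed
  have \<beta>: "?\<beta> \<xi> x = \<xi> (inv \<alpha> x)" for \<xi> x by (simp add: transpose_on_def)
  have circ_linear: "linear_on fun_scale fun_scale ?D ?D (commutator circ \<xi>)"
    "linear_on fun_scale fun_scale ?D ?D (right_mult circ \<xi>)" if "\<xi> \<in> ?D" for \<xi>
    using bilinear_onD(1)[OF hom_lie_algebra.bracket_bilinear[OF D.sub_adjacent] that]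
      bilinear_onD(2)[OF D.mult_bilinear that]
    by (auto simp: right_mult_def[abs_def])
  have coadj: "coadj_star UNIV \<alpha> M x \<xi> = (\<lambda>y. - \<xi> (inv \<alpha> (inv \<alpha> (M (\<alpha> x) y))))" for M x and \<xi> :: "'a \<Rightarrow> 'k"
    by (simp add: coadj_star_def coadj_def transpose_on_def numeral_2_eq_2)
  have coadj_closed: "coadj_star UNIV \<alpha> M x \<xi> \<in> ?D"
    if "\<xi> \<in> ?D" "\<And>x. linear_on scale scale UNIV UNIV (M x)" for M x \<xi>
    using linear_onD(2,3)[OF that(2)] that(1)
    by (auto simp: dual_def[of scale] linear_on_def coadj inv_linear lin[OF that(1)])
  have mult_linear: "linear_on scale scale UNIV UNIV (commutator mult x)"
    "linear_on scale scale UNIV UNIV (right_mult mult x)" for x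
    using bilinear_onD(1)[OF hom_lie_algebra.bracket_bilinear[OF A.sub_adjacent]]
      bilinear_onD(2)[OF A.mult_bilinear]
    by (auto simp: right_mult_def[abs_def])
  \<comment> \<open>Linearity of the operators on the dual guarantees that the element chosen by the
    definite description exists, so its defining pairing property may be used.\<close>
  have dual_coadj: "\<eta> (dual_coadj scale UNIV (commutator circ) (?\<beta> \<xi>) x) = - commutator circ (?\<beta> \<xi>) \<eta> x"
    "\<eta> (dual_coadj scale UNIV (right_mult circ) (?\<beta> \<xi>) x) = - right_mult circ (?\<beta> \<xi>) \<eta> x"
    if "\<xi> \<in> ?D" "\<eta> \<in> ?D" for \<xi> \<eta> x
    using A.dual_coadj(2) circ_linear D.alpha_closed that by blast+
  show ?thesis
  proof unfold_locales
    show "bilinear_on scale fun_scale (*) UNIV ?D UNIV (\<lambda>x \<xi>. \<xi> x)"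
      by (auto simp: bilinear_on_def linear_on_def lin) (simp add: fun_scale_def)
    show "bij_betw (\<lambda>\<xi> x. if x \<in> UNIV then \<xi> x else 0) ?D ?D"
      by (simp add: bij_betw_def)
    \<comment> \<open>Finite dimension enters here: evaluation identifies the space with its
      bidual.\<close>
    show "bij_betw (\<lambda>x \<xi>. if \<xi> \<in> ?D then \<xi> x else 0) UNIV (dual fun_scale ?D)"
      using A.bidual_embed_bij by (simp add: bidual_embed_def[abs_def])
    show "?\<beta> \<xi> (\<alpha> x) = \<xi> x" for \<xi> :: "'a \<Rightarrow> 'k" and x by (simp add: \<beta>)
    fix x y :: 'a and \<xi> \<eta> :: "'a \<Rightarrow> 'k"
    assume \<xi>: "\<xi> \<in> ?D"
    show "coadj_star UNIV \<alpha> (commutator mult) x \<xi> \<in> ?D"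
      using \<xi> mult_linear(1) by (rule coadj_closed)
    show "- coadj_star UNIV \<alpha> (right_mult mult) x \<xi> \<in> ?D"
      using \<xi> mult_linear(2) by (intro D.closed_V(4) coadj_closed)
    show "coadj_star UNIV \<alpha> (commutator mult) x \<xi> y = - ?\<beta> (?\<beta> \<xi>) (commutator mult (\<alpha> x) y)"
      by (simp add: coadj \<beta>)
    show "(- coadj_star UNIV \<alpha> (right_mult mult) x \<xi>) y = ?\<beta> (?\<beta> \<xi>) (mult y (\<alpha> x))"
      by (simp add: coadj \<beta> right_mult_def)
    assume \<eta>: "\<eta> \<in> ?D"
    show "\<eta> (dual_coadj_star scale UNIV \<alpha> (commutator circ) \<xi> x) = - commutator circ (?\<beta> \<xi>) \<eta> (\<alpha> (\<alpha> x))"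
      using \<xi> \<eta> by (simp add: dual_coadj_star_def dual_coadj numeral_2_eq_2)
    show "\<eta> (- dual_coadj_star scale UNIV \<alpha> (right_mult circ) \<xi> x) = circ \<eta> (?\<beta> \<xi>) (\<alpha> (\<alpha> x))"
      using \<xi> \<eta> by (simp add: dual_coadj_star_def dual_coadj numeral_2_eq_2 lin right_mult_def)
  qed auto
qed

theorem theorem3p8:
  fixes scale :: "'k::field \<Rightarrow> 'a::ab_group_add \<Rightarrow> 'a"
    and mult :: "'a \<Rightarrow> 'a \<Rightarrow> 'a" and \<alpha> :: "'a \<Rightarrow> 'a"
    and circ :: "('a \<Rightarrow> 'k) \<Rightarrow> ('a \<Rightarrow> 'k) \<Rightarrow> ('a \<Rightarrow> 'k)"
  assumes "regular_hom_pre_lie_algebra scale UNIV mult \<alpha>"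
    and "regular_hom_pre_lie_algebra fun_scale (dual scale UNIV) circ (transpose_on UNIV (inv \<alpha>))"
  shows "(hom_pre_lie_bialgebra scale UNIV mult \<alpha> circ \<longleftrightarrow>
            hom_pre_lie_matched_pair
              scale UNIV mult \<alpha>
              fun_scale (dual scale UNIV) circ (transpose_on UNIV (inv \<alpha>))
              (coadj_star UNIV \<alpha> (commutator mult))
              (\<lambda>x \<xi>. - coadj_star UNIV \<alpha> (right_mult mult) x \<xi>)
              (dual_coadj_star scale UNIV \<alpha> (commutator circ))
              (\<lambda>\<xi> x. - dual_coadj_star scale UNIV \<alpha> (right_mult circ) \<xi> x)) \<and>
         (hom_pre_lie_matched_pair
              scale UNIV mult \<alpha>
              fun_scale (dual scale UNIV) circ (transpose_on UNIV (inv \<alpha>))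
              (coadj_star UNIV \<alpha> (commutator mult))
              (\<lambda>x \<xi>. - coadj_star UNIV \<alpha> (right_mult mult) x \<xi>)
              (dual_coadj_star scale UNIV \<alpha> (commutator circ))
              (\<lambda>\<xi> x. - dual_coadj_star scale UNIV \<alpha> (right_mult circ) \<xi> x) \<longleftrightarrow>
            standard_manin_triple scale UNIV mult \<alpha> circ)"
proof -
  let ?D = "dual scale UNIV" and ?\<beta> = "transpose_on UNIV (inv \<alpha>)"
  let ?l = "coadj_star UNIV \<alpha> (commutator mult)"
    and ?r = "\<lambda>x \<xi>. - coadj_star UNIV \<alpha> (right_mult mult) x \<xi>"
    and ?l' = "dual_coadj_star scale UNIV \<alpha> (commutator circ)"
    and ?r' = "\<lambda>\<xi> x. - dual_coadj_star scale UNIV \<alpha> (right_mult circ) \<xi> x"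
  interpret P: hom_dual_pair scale UNIV mult \<alpha> fun_scale ?D circ ?\<beta> "\<lambda>x \<xi>. \<xi> x" ?l ?r ?l' ?r'
    using assms by (rule standard_dual_pair)
  \<comment> \<open>In the swapped pair the space is the dual of \<open>?D\<close>, and
    \<open>Q.functional\<close> coincides with the bidual embedding used by
    \<open>dual_coproduct\<close>.\<close>
  interpret Q: hom_dual_pair fun_scale ?D circ ?\<beta> scale UNIV mult \<alpha> "\<lambda>\<xi> x. \<xi> x" ?l' ?r' ?l ?r
    by (rule P.swap)
  have "P.functional \<xi> = \<xi>" for \<xi> by (simp add: P.functional_def)
  then have "hom_lie_cocycle scale UNIV (commutator mult) \<alpha> tensor_scale (tensor_square scale UNIV)
      (tensor_map scale UNIV \<alpha> \<alpha>) (tensor_action scale UNIV mult \<alpha> (inv \<alpha> ^^ 2))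
      (coproduct scale UNIV circ) \<longleftrightarrow> P.u.cocycle"
    using P.V.coproduct[OF P.W.mult_bilinear]
    by (intro P.cocycle_iff) (simp_all add: P.ai_def numeral_2_eq_2)
  \<comment> \<open>\<open>?\<beta>\<close> is precomposition with the inverse of \<alpha>, so its
    own inverse \<open>Q.ai\<close> on \<open>?D\<close> is precomposition with \<alpha>.\<close>
  moreover have "transpose_on UNIV (\<alpha> ^^ 2) \<xi> = Q.ai (Q.ai \<xi>)" if "\<xi> \<in> ?D" for \<xi>
  proof -
    have "?\<beta> \<eta> \<circ> \<alpha> = \<eta>" for \<eta> :: "'a \<Rightarrow> 'k"
      using P.pairing_twist P.V.regular by (auto simp: transpose_on_def fun_eq_iff bij_is_inj)
    then have "\<eta> \<circ> \<alpha> = Q.ai \<eta>" if "\<eta> \<in> ?D" for \<eta>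
      using Q.ai(2)[OF that] by metis
    then show ?thesis
      using that Q.ai(1) by (simp add: transpose_on_def numeral_2_eq_2 fun_eq_iff)
  qed
  then have "hom_lie_cocycle fun_scale ?D (commutator circ) ?\<beta> tensor_scale (tensor_square fun_scale ?D)
      (tensor_map fun_scale ?D ?\<beta> ?\<beta>) (tensor_action fun_scale ?D circ ?\<beta> (transpose_on UNIV (\<alpha> ^^ 2)))
      (dual_coproduct scale UNIV mult) \<longleftrightarrow> Q.u.cocycle"
    using P.V.dual_coproduct[OF P.V.mult_bilinear]
    by (intro Q.cocycle_iff) (simp_all add: Q.functional_def bidual_embed_def)
  \<comment> \<open>After rewriting with \<open>P.swapped_untwisted\<close>,
    \<open>Q.u.cocycle\<close> is \<open>P.dual_cocycle\<close>.\<close>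
  ultimately have "hom_pre_lie_bialgebra scale UNIV mult \<alpha> circ \<longleftrightarrow> P.u.cocycle \<and> P.dual_cocycle"
    using assms unfolding hom_pre_lie_bialgebra_def P.swapped_untwisted by blast
  moreover have "P.hom_double = double_mult scale UNIV mult \<alpha> circ"
    by (auto simp: P.hom_double_def double_mult_def fun_eq_iff)
  moreover have "P.pair_form = double_form"
    by (auto simp: P.pair_form_def double_form_def)
  ultimately show ?thesis
    using P.matched_pair_iff P.manin_triple_iff unfolding standard_manin_triple_def by simp
qed

end
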